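(* Let $n\ge 1$, let $\boldsymbol{\mu}\in\mathbb{R}^n$, let $\Sigma\in\mathbb{R}^{n\times n}$ be symmetric positive definite, and let $\mathbf{m}\sim\mathcal{N}(\boldsymbol{\mu},\Sigma)$ be a prior. Fix an index $i\in\{1,\dots,n\}$ and a measurement $y_i\in\{-1,1\}$ with Bernoulli likelihood $p(y_i\mid \mathbf{m})=\Phi(y_i m_i;0,1)$. Let $p(\mathbf{m})$ denote the posterior density, i.e. the probability density proportional to $\phi(\mathbf{m};\boldsymbol{\mu},\Sigma)\,\Phi(y_i m_i;0,1)$. Consider the following two ways of approximating $p$ by a normal density $\mathcal{N}(\hat{\boldsymbol{\mu}},\hat\Sigma)$: (1) take $(\hat{\boldsymbol{\mu}}_c,\hat\Sigma_c)$ minimizing $$\mathrm{KL}\big(\phi(\mathbf{m};\hat{\boldsymbol{\mu}}_c,\hat\Sigma_c)\,\big\|\,\phi(\mathbf{m};\boldsymbol{\mu},\Sigma)\Phi(y_i m_i;0,1)\big);$$ (2) take $(\tilde\mu_i,\tilde\sigma_i^2)$ minimizing $$\mathrm{KL}\Big(\int \phi(\mathbf{m};\boldsymbol{\mu},\Sigma)\,\phi(m_i;\tilde\mu_i,\tilde\sigma_i^2)\,\prod_{j\ne i}dm_j\;\Big\|\;\int \phi(\mathbf{m};\boldsymbol{\mu},\Sigma)\,\Phi(y_i m_i;0,1)\,\prod_{j\ne i}dm_j\Big),$$ where both arguments (functions of $m_i$) are normalized to probability densities, and then form the normal density proportional to $\phi(\mathbf{m};\boldsymbol{\mu},\Sigma)\,\phi(m_i;\tilde\mu_i,\tilde\sigma_i^2)$.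 Then the two approaches give the same result: $\phi(\mathbf{m};\hat{\boldsymbol{\mu}}_c,\hat\Sigma_c)$ is equal to the normalized density proportional to $\phi(\mathbf{m};\boldsymbol{\mu},\Sigma)\,\phi(m_i;\tilde\mu_i,\tilde\sigma_i^2)$.
   Context: $\phi(\cdot;\mathbf{a},B)$ denotes the normal probability density function with mean $\mathbf{a}$ and covariance $B$ (in one dimension, $\phi(x;a,s^2)$ with variance $s^2>0$). $\Phi(x;0,1)=\int_{-\infty}^x\phi(u;0,1)\,du$ is the standard normal cumulative distribution function (probit function). $\mathrm{KL}(p\|q)=\int p(x)\log\big(p(x)/q(x)\big)\,dx$ is the Kullback–Leibler divergence. $m_i$ denotes the $i$-th coordinate of $\mathbf{m}$. Normalization constants of the densities are ignored, i.e. all densities in the KL divergences are taken normalized. *)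

theory Defs
  imports "HOL-Probability.Probability"
begin

definition sym_pos_def :: "real^'n^'n \<Rightarrow> bool" where
  "sym_pos_def S \<longleftrightarrow> transpose S = S \<and> (\<forall>x. x \<noteq> 0 \<longrightarrow> 0 < x \<bullet> (S *v x))"

definition mvn_pdf :: "real^'n \<Rightarrow> real^'n^'n \<Rightarrow> real^'n \<Rightarrow> real" where
  "mvn_pdf a B m =
     exp (- (1/2) * ((m - a) \<bullet> (matrix_inv B *v (m - a)))) / sqrt ((2 * pi) ^ CARD('n) * det B)"

definition npdf1 :: "real \<Rightarrow> real \<Rightarrow> real \<Rightarrow> real" where
  "npdf1 a s2 x = normal_density a (sqrt s2) x"

definition Phi :: "real \<Rightarrow> real" where
  "Phi x = (LINT u:{..x}|lborel. std_normal_density u)"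

definition normalize_dens :: "('a::euclidean_space \<Rightarrow> real) \<Rightarrow> 'a \<Rightarrow> real" where
  "normalize_dens f = (\<lambda>x. f x / (\<integral>z. f z \<partial>lborel))"

definition KL :: "('a::euclidean_space \<Rightarrow> real) \<Rightarrow> ('a \<Rightarrow> real) \<Rightarrow> ereal" where
  "KL p q = (let p' = normalize_dens p; q' = normalize_dens q;
                 g = (\<lambda>x. p' x * ln (p' x / q' x))
             in if integrable lborel g then ereal (\<integral>x. g x \<partial>lborel) else \<infinity>)"

definition marg :: "(real^'n \<Rightarrow> real) \<Rightarrow> 'n \<Rightarrow> real \<Rightarrow> real" where
  "marg f i t = (\<integral>z. f (\<chi> j. if j = i then t else z j) \<partial>(PiM (UNIV - {i}) (\<lambda>_. lborel)))"

end

theory Submission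
  imports Defs "HOL-Real_Asymp.Real_Asymp"
begin

text \<open>The likelihood depends on $m_i$ only, so by the chain rule for the divergence a minimiser in the first
  approach keeps the conditionals of the prior given $m_i$, and both approaches minimise the same
  one-dimensional divergence of $\mathcal{N}(a, s^2)$ from the marginal posterior of $m_i$. The second approach
  only reaches variances $s^2 < \Sigma_{ii}$, because $1/s^2 = 1/\Sigma_{ii} + 1/\tilde\sigma_i^2$. Since $\Phi$ is
  log-concave, the one-dimensional divergence is strictly convex in $(a, s)$, so a minimiser over the open
  strip $s^2 < \Sigma_{ii}$ is the unique global one.\<close>

subsection \<open>Symmetric positive definite matrices\<close>

text \<open>The obstacle is that the two minimality hypotheses range over different families: the
  marginal variance \<open>v\<close> of the first minimiser is not known to lie below
  \<open>\<Sigma> $ i $ i\<close>, while the second hypothesis says nothing beyond that bound.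
  Convexity, not only minimality, has to bridge this. The comparison runs one way: the normal
  density produced by the second approach is admissible in the first, so the first minimiser has at
  most its divergence. Conditional distributions are never constructed. Multiplying the prior by a
  quotient of two one-dimensional normal densities in \<open>m $ i\<close> exchanges the marginal
  and leaves the dependence on the other coordinates untouched; such a density (\<open>tilt\<close>
  in the final proof) stands for "same conditionals, new marginal". The scale \<open>s\<close> is
  used in place of the variance because \<open>a + s * z\<close> is linear in \<open>(a, s)\<close>
  for fixed \<open>z\<close>, so that log-concavity passes through the substitution. Since
  \<open>KL\<close> is infinite when its integrand is not integrable, integrability has to be
  carried along with every value of an integral.\<close>

lemma sym_pos_def_inner_commute:
  "sym_pos_def S \<Longrightarrow> x \<bullet> (S *v y) = y \<bullet> (S *v x)"
  unfolding sym_pos_def_def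
  by (metis dot_lmul_matrix inner_commute transpose_matrix_vector)

lemma sym_pos_def_invertible:
  assumes "sym_pos_def S"
  shows "invertible S"
proof -
  have "S *v x = 0 \<Longrightarrow> x = 0" for x
    using assms unfolding sym_pos_def_def by (metis inner_zero_right less_irrefl)
  then show ?thesis
    unfolding invertible_left_inverse matrix_left_invertible_ker by blast
qed

lemma matrix_inv_invertible:
  assumes "invertible S"
  shows "S ** matrix_inv S = mat 1" "matrix_inv S ** S = mat 1"
proof -
  have "S ** matrix_inv S = mat 1 \<and> matrix_inv S ** S = mat 1"
    unfolding matrix_inv_def using assms[unfolded invertible_def] by (rule someI_ex)
  then show "S ** matrix_inv S = mat 1" "matrix_inv S ** S = mat 1" by auto
qed

lemma matrix_inv_unique:
  assumes "A ** B = mat 1" "B ** A = mat 1"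
  shows "matrix_inv A = B"
  by (metis assms invertible_def matrix_inv_invertible(2) matrix_mul_assoc matrix_mul_lid matrix_mul_rid)

lemma sym_pos_def_matrix_inv:
  assumes "sym_pos_def S"
  shows "sym_pos_def (matrix_inv S)"
proof -
  note inv = matrix_inv_invertible[OF sym_pos_def_invertible[OF assms]]
  have S: "transpose S = S" using assms by (simp add: sym_pos_def_def)
  have "transpose (matrix_inv S) = matrix_inv S"
    by (metis S inv matrix_inv_unique matrix_transpose_mul transpose_mat)
  moreover have "0 < x \<bullet> (matrix_inv S *v x)" if "x \<noteq> 0" for x
  proof -
    define w where "w = matrix_inv S *v x"
    have "S *v w = x" by (simp add: w_def matrix_vector_mul_assoc inv)
    moreover from this have "w \<noteq> 0" using that by auto
    ultimately show ?thesis
      using assms unfolding sym_pos_def_def w_def[symmetric] by (metis inner_commute)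
  qed
  ultimately show ?thesis by (simp add: sym_pos_def_def)
qed

lemma matrix_inv_matrix_inv:
  "invertible S \<Longrightarrow> matrix_inv (matrix_inv S) = S"
  by (intro matrix_inv_unique matrix_inv_invertible)

lemma sym_pos_def_diag_pos:
  assumes "sym_pos_def S"
  shows "0 < S $ i $ i"
proof -
  have "0 < axis i 1 \<bullet> (S *v axis i 1)"
    using assms unfolding sym_pos_def_def by (simp add: axis_eq_0_iff)
  then show ?thesis
    by (simp add: inner_axis' matrix_vector_mult_basis column_def)
qed

text \<open>The witness is column \<open>i\<close> of \<open>S\<close> divided by its diagonal
  entry. It spans the direction orthogonal, for the form of \<open>matrix_inv S\<close>, to the
  hyperplane of vectors with zero coordinate \<open>i\<close>.\<close>

lemma sym_pos_def_pivot:
  fixes S :: "real^'n^'n"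
  assumes "sym_pos_def S"
  obtains b where "b $ i = 1" "matrix_inv S *v b = (1 / S $ i $ i) *\<^sub>R axis i 1"
proof
  let ?b = "(1 / S $ i $ i) *\<^sub>R (S *v axis i 1)"
  have "S $ i $ i \<noteq> 0" using sym_pos_def_diag_pos[OF assms, of i] by simp
  then show "?b $ i = 1"
    by (simp add: matrix_vector_mult_basis column_def)
  show "matrix_inv S *v ?b = (1 / S $ i $ i) *\<^sub>R axis i 1"
    by (simp only: matrix_vector_mult_scaleR matrix_vector_mul_assoc
        matrix_inv_invertible(2)[OF sym_pos_def_invertible[OF assms]] matrix_vector_mul_lid)
qed

text \<open>Pythagoras for the form \<open>M\<close>: the cross term is a multiple of
  \<open>w $ i\<close>, hence zero.\<close>

lemma quadratic_form_split:
  fixes M :: "real^'n^'n"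
  assumes M: "sym_pos_def M" and b: "b $ i = 1" "M *v b = d *\<^sub>R axis i 1" and w: "w $ i = 0"
  shows "(w + s *\<^sub>R b) \<bullet> (M *v (w + s *\<^sub>R b)) = w \<bullet> (M *v w) + d * s\<^sup>2"
proof -
  have "w \<bullet> (M *v b) = 0" "b \<bullet> (M *v b) = d"
    using b w by (simp_all add: inner_axis)
  moreover have "b \<bullet> (M *v w) = w \<bullet> (M *v b)"
    using sym_pos_def_inner_commute[OF M] .
  ultimately show ?thesis
    by (simp add: matrix_vector_right_distrib matrix_vector_mult_scaleR inner_add_left inner_add_right
        power2_eq_square)
qed

definition shear :: "'n \<Rightarrow> real^'n \<Rightarrow> real^'n^'n" where
  "shear i c = (\<chi> j k. (if j = k then 1 else 0) + (if k = i then c $ j else 0))"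

lemma shear_mult: "shear i c *v x = x + (x $ i) *\<^sub>R c"
  by (simp add: shear_def vec_eq_iff matrix_vector_mult_def distrib_right sum.distrib
      if_distrib[of "\<lambda>u. u * _"] cong: if_cong)

text \<open>Because \<open>c $ i = 0\<close>, \<open>c\<close> is a combination of the unit vectors
  other than \<open>axis i 1\<close>; the transposed shear thus arises from the identity by adding
  to row \<open>i\<close> a combination of the other rows.\<close>

lemma det_shear:
  fixes c :: "real^'n"
  assumes "c $ i = 0"
  shows "det (shear i c) = 1"
proof -
  have "c = (\<Sum>k\<in>UNIV. c $ k *s axis k 1)"
    by (simp add: basis_expansion)
  also have "\<dots> = (\<Sum>k\<in>UNIV - {i}. c $ k *s axis k 1)"
    by (rule sum.mono_neutral_right) (auto simp: assms)
  also have "\<dots> \<in> vec.span {row j (mat 1 :: real^'n^'n) |j. j \<noteq> i}"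
  proof (intro vec.span_sum vec.span_scale vec.span_base)
    fix k assume "k \<in> UNIV - {i}"
    moreover have "axis k 1 = row k (mat 1 :: real^'n^'n)"
      by (auto simp: vec_eq_iff row_def mat_def axis_def)
    ultimately show "axis k 1 \<in> {row j (mat 1 :: real^'n^'n) |j. j \<noteq> i}" by auto
  qed
  finally have "det (\<chi> k. if k = i then row i (mat 1) + c else row k (mat 1)) = det (mat 1 :: real^'n^'n)"
    by (rule det_row_span)
  moreover have "(\<chi> k. if k = i then row i (mat 1) + c else row k (mat 1)) = transpose (shear i c)"
    by (auto simp: vec_eq_iff row_def mat_def shear_def transpose_def)
  ultimately show ?thesis by (simp add: det_transpose)
qed

lemma matrix_entry: "(M::real^'n^'n) $ j $ k = axis j 1 \<bullet> (M *v axis k 1)"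
  by (simp add: inner_axis' matrix_vector_mult_basis column_def)

subsection \<open>Lebesgue measure on coordinates and Gaussian integrals\<close>

lemma borel_measurable_vec_lambda:
  assumes "\<And>j. (\<lambda>x. f x j) \<in> borel_measurable M"
  shows "(\<lambda>x. (\<chi> j. f x j) :: real^'n) \<in> borel_measurable M"
  using assms by (subst borel_measurable_euclidean_space) (auto simp: Basis_vec_def inner_axis)

lemma prod_Basis_vec: "(\<Prod>b\<in>Basis. (x::real^'n) \<bullet> b) = (\<Prod>j\<in>UNIV. x $ j)"
proof -
  have B: "(Basis :: (real^'n) set) = range (\<lambda>j. axis j 1)"
    by (auto simp: Basis_vec_def)
  have inj: "inj (\<lambda>j. axis j 1 :: real^'n)"
    by (auto simp: inj_def axis_eq_axis)
  show ?thesis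
    unfolding B prod.reindex[OF inj] by (simp add: cart_eq_inner_axis o_def)
qed

text \<open>\<open>lborel\<close> on vectors is built from \<open>Basis\<close>, whereas
  \<open>marg\<close> integrates over a product indexed by coordinates. Agreement on boxes
  identifies the two.\<close>

lemma lborel_vec_eq_PiM:
  "(lborel :: (real^'n) measure) = distr (PiM UNIV (\<lambda>_. lborel)) borel (\<lambda>f. \<chi> j. f j)"
proof (rule lborel_eqI)
  interpret product_sigma_finite "\<lambda>_::'n. lborel :: real measure" by standard
  have meas: "(\<lambda>f. \<chi> j. f j) \<in> measurable (PiM UNIV (\<lambda>_::'n. lborel :: real measure)) borel"
    by (intro borel_measurable_vec_lambda) simp 
  fix l u :: "real^'n"
  assume le: "\<And>b. b \<in> Basis \<Longrightarrow> l \<bullet> b \<le> u \<bullet> b"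
  have le': "l $ j \<le> u $ j" for j
    using le[of "axis j 1"] by (simp add: inner_axis axis_in_Basis_iff)
  have "emeasure (distr (PiM UNIV (\<lambda>_. lborel)) borel (\<lambda>f. \<chi> j. f j)) (box l u)
      = emeasure (PiM UNIV (\<lambda>_. lborel)) ((\<lambda>f. \<chi> j. f j) -` box l u \<inter> space (PiM UNIV (\<lambda>_. lborel)))"
    using meas by (simp add: emeasure_distr)
  also have "(\<lambda>f. \<chi> j. f j) -` box l u \<inter> space (PiM UNIV (\<lambda>_. lborel)) = (\<Pi>\<^sub>E j\<in>UNIV. {l$j<..<u$j})"
    by (force simp: mem_box_cart space_PiM PiE_iff)
  also have "emeasure (PiM UNIV (\<lambda>_. lborel)) \<dots> = (\<Prod>j\<in>UNIV. emeasure lborel {l$j<..<u$j})"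
    by (rule emeasure_PiM) auto
  also have "\<dots> = (\<Prod>j\<in>UNIV. ennreal (u$j - l$j))"
    by (simp add: le')
  also have "\<dots> = ennreal (\<Prod>j\<in>UNIV. u$j - l$j)"
    by (rule prod_ennreal) (simp add: le')
  also have "(\<Prod>j\<in>UNIV. u$j - l$j) = (\<Prod>b\<in>Basis. (u - l) \<bullet> b)"
    by (simp add: prod_Basis_vec)
  finally show "emeasure (distr (PiM UNIV (\<lambda>_. lborel)) borel (\<lambda>f. \<chi> j. f j)) (box l u) = (\<Prod>b\<in>Basis. (u - l) \<bullet> b)" 
   by simp
qed simp


lemma measurable_insert_coord [measurable]:
  "(\<lambda>z. (\<chi> j. if j = i then t else z j) :: real^'n)
    \<in> borel_measurable (PiM (UNIV - {i}) (\<lambda>_. lborel :: real measure))"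
proof (rule borel_measurable_vec_lambda)
  fix j
  show "(\<lambda>z. if j = i then t else z j) \<in> borel_measurable (PiM (UNIV - {i}) (\<lambda>_. lborel :: real measure))"
    by (cases "j = i") (auto intro!: borel_measurable_const 
      measurable_component_singleton[of j "UNIV - {i}" "\<lambda>_. lborel :: real measure", simplified])
qed

text \<open>The inner integral is over the same slices as in \<open>marg\<close>; nonnegative
  integrals avoid integrability conditions.\<close>

lemma nn_integral_vec_Fubini:
  fixes f :: "real^'n \<Rightarrow> ennreal"
  assumes [measurable]: "f \<in> borel_measurable borel"
  shows "(\<integral>\<^sup>+x. f x \<partial>lborel) =
    (\<integral>\<^sup>+t. \<integral>\<^sup>+z. f (\<chi> j. if j = i then t else z j) \<partial>PiM (UNIV - {i}) (\<lambda>_. lborel) \<partial>lborel)"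
proof -
  interpret product_sigma_finite "\<lambda>_::'n. lborel :: real measure" by standard
  have vec: "(\<lambda>z. (\<chi> j. z j) :: real^'n) \<in> borel_measurable (PiM UNIV (\<lambda>_::'n. lborel :: real measure))"
    by (intro borel_measurable_vec_lambda) simp
  have ins: "UNIV = insert i (UNIV - {i})" by auto
  have m: "(\<lambda>z. f (\<chi> j. z j)) \<in> borel_measurable (PiM UNIV (\<lambda>_::'n. lborel :: real measure))"
    using vec by measurable
  have "(\<integral>\<^sup>+x. f x \<partial>lborel) = (\<integral>\<^sup>+z. f (\<chi> j. z j) \<partial>PiM UNIV (\<lambda>_. lborel))"
    using vec by (subst lborel_vec_eq_PiM) (simp add: nn_integral_distr)
  also have "\<dots> = (\<integral>\<^sup>+z. f (\<chi> j. z j) \<partial>PiM (insert i (UNIV - {i})) (\<lambda>_. lborel))"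
    using ins by simp
  also have "\<dots> = (\<integral>\<^sup>+t. \<integral>\<^sup>+z. f (\<chi> j. (z(i := t)) j) \<partial>PiM (UNIV - {i}) (\<lambda>_. lborel) \<partial>lborel)"
    using m ins by (intro product_nn_integral_insert_rev) auto
  finally show ?thesis by (simp add: fun_upd_def)
qed

text \<open>The preimage of a rectangle is a rectangle, so invariance of each factor is enough. The
  restriction to \<open>I\<close> keeps points extensional, as the product space demands.\<close>

lemma nn_integral_PiM_translate:
  fixes I :: "'i set" and d :: "'i \<Rightarrow> real"
  assumes I: "finite I" and f: "f \<in> borel_measurable (PiM I (\<lambda>_. lborel))"
  shows "(\<integral>\<^sup>+z. f (\<lambda>j\<in>I. z j + d j) \<partial>PiM I (\<lambda>_. lborel)) = (\<integral>\<^sup>+z. f z \<partial>PiM I (\<lambda>_. lborel))"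
proof -
  interpret product_sigma_finite "\<lambda>_::'i. lborel :: real measure" by standard
  let ?T = "\<lambda>z. \<lambda>j\<in>I. z j + d j" and ?P = "PiM I (\<lambda>_. lborel :: real measure)"
  have T: "?T \<in> measurable ?P ?P"
    by (intro measurable_restrict) (simp add: measurable_component_singleton)
  have "distr ?P ?P ?T = ?P"
  proof (rule PiM_eqI[OF I])
    fix A :: "'i \<Rightarrow> real set" assume A: "\<And>j. j \<in> I \<Longrightarrow> A j \<in> sets lborel"
    have A': "(\<lambda>x. d j + x) -` A j \<in> sets borel" if "j \<in> I" for j
      using A[OF that] measurable_sets_borel[of "\<lambda>x. d j + x" borel "A j"] by simp
    have "emeasure (distr ?P ?P ?T) (Pi\<^sub>E I A) = emeasure ?P (?T -` Pi\<^sub>E I A \<inter> space ?P)"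
      using T A I by (intro emeasure_distr sets_PiM_I_finite) auto
    also have "?T -` Pi\<^sub>E I A \<inter> space ?P = (\<Pi>\<^sub>E j\<in>I. (\<lambda>x. d j + x) -` A j)"
      by (auto simp: space_PiM PiE_iff add.commute)
    also have "emeasure ?P \<dots> = (\<Prod>j\<in>I. emeasure lborel ((\<lambda>x. d j + x) -` A j))"
      using A' I by (intro emeasure_PiM) auto
    also have "\<dots> = (\<Prod>j\<in>I. emeasure (distr lborel borel ((+) (d j))) (A j))"
      using A by (intro prod.cong refl) (simp add: emeasure_distr)
    finally show "emeasure (distr ?P ?P ?T) (Pi\<^sub>E I A) = (\<Prod>j\<in>I. emeasure lborel (A j))"
      unfolding lborel_distr_plus .
  qed simp
  then have "(\<integral>\<^sup>+z. f z \<partial>?P) = (\<integral>\<^sup>+z. f z \<partial>distr ?P ?P ?T)" by simp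
  also have "\<dots> = (\<integral>\<^sup>+z. f (?T z) \<partial>?P)"
    using T f by (intro nn_integral_distr) auto
  finally show ?thesis by simp
qed

lemma nn_integral_slice_translate:
  fixes f :: "real^'n \<Rightarrow> ennreal"
  assumes [measurable]: "f \<in> borel_measurable borel"
  shows "(\<integral>\<^sup>+z. f ((\<chi> j. if j = i then t else z j) + d) \<partial>PiM (UNIV - {i}) (\<lambda>_. lborel)) =
    (\<integral>\<^sup>+z. f (\<chi> j. if j = i then t + d $ i else z j) \<partial>PiM (UNIV - {i}) (\<lambda>_. lborel))"
proof -
  have "(\<integral>\<^sup>+z. f ((\<chi> j. if j = i then t else z j) + d) \<partial>PiM (UNIV - {i}) (\<lambda>_. lborel)) =
    (\<integral>\<^sup>+z. f (\<chi> j. if j = i then t + d $ i else (\<lambda>j\<in>UNIV-{i}. z j + d $ j) j) \<partial>PiM (UNIV - {i}) (\<lambda>_. lborel))"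
    by (intro nn_integral_cong arg_cong[where f=f]) (auto simp: vec_eq_iff)
  also have "\<dots> = (\<integral>\<^sup>+z. f (\<chi> j. if j = i then t + d $ i else z j) \<partial>PiM (UNIV - {i}) (\<lambda>_. lborel))"
    by (rule nn_integral_PiM_translate) auto
  finally show ?thesis .
qed

text \<open>On the slice where coordinate \<open>i\<close> equals \<open>t\<close>, the shear is
  translation by \<open>t *\<^sub>R c\<close>, which stays inside the slice because
  \<open>c $ i = 0\<close>.\<close>

lemma nn_integral_shear:
  fixes f :: "real^'n \<Rightarrow> ennreal"
  assumes [measurable]: "f \<in> borel_measurable borel" and c: "c $ i = 0"
  shows "(\<integral>\<^sup>+x. f (shear i c *v x) \<partial>lborel) = (\<integral>\<^sup>+x. f x \<partial>lborel)"
proof -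
  have "(\<lambda>x. f (shear i c *v x)) \<in> borel_measurable borel"
    unfolding shear_mult by measurable
  then have "(\<integral>\<^sup>+x. f (shear i c *v x) \<partial>lborel) = (\<integral>\<^sup>+t. \<integral>\<^sup>+z. 
     f ((\<chi> j. if j = i then t else z j) + t *\<^sub>R c) \<partial>PiM (UNIV - {i}) (\<lambda>_. lborel) \<partial>lborel)"
    by (subst nn_integral_vec_Fubini[where i=i]) (simp_all add: shear_mult)
  also have "\<dots> = (\<integral>\<^sup>+x. f x \<partial>lborel)"
    unfolding nn_integral_slice_translate[OF assms(1)] nn_integral_vec_Fubini[OF assms(1), of i]
    by (simp add: c cong: if_cong)
  finally show ?thesis .
qed

section \<open>One-dimensional normal densities and the Gaussian integral\<close>

lemma npdf1_eq: "0 < v \<Longrightarrow> npdf1 a v t = exp (- (t - a)\<^sup>2 / (2 * v)) / sqrt (2 * pi * v)"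
  by (simp add: npdf1_def normal_density_def)

lemma npdf1_pos: "0 < v \<Longrightarrow> 0 < npdf1 a v t"
  unfolding npdf1_def by (simp add: normal_density_pos)

lemma npdf1_nonneg [simp]: "0 \<le> npdf1 a v t"
  unfolding npdf1_def by simp

lemma borel_measurable_npdf1 [measurable]: "npdf1 a v \<in> borel_measurable borel"
  unfolding npdf1_def[abs_def] by measurable

lemma nn_integral_npdf1: 
  assumes "0 < v"
  shows "(\<integral>\<^sup>+t. ennreal (npdf1 a v t) \<partial>lborel) = 1"
  using assms unfolding npdf1_def
  by (subst nn_integral_eq_integral) auto

lemma sym_pos_def_congruence:
  fixes M :: "real^'n^'n"
  assumes M: "sym_pos_def M" and C: "invertible C"
  shows "sym_pos_def (transpose C ** M ** C)"
proof -
  have "C *v x = 0 \<Longrightarrow> x = 0" for x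
    using matrix_inv_invertible(2)[OF C] matrix_left_invertible_ker[of C] by blast
  moreover have "x \<bullet> ((transpose C ** M ** C) *v x) = (C *v x) \<bullet> (M *v (C *v x))" for x
    by (metis dot_lmul_matrix inner_commute matrix_vector_mul_assoc transpose_matrix_vector)
  moreover have "transpose (transpose C ** M ** C) = transpose C ** M ** C"
    using M by (simp add: sym_pos_def_def matrix_transpose_mul matrix_mul_assoc)
  ultimately show ?thesis
    using M unfolding sym_pos_def_def by metis
qed

lemma borel_measurable_matrix_vector_mult [measurable]:
  fixes M :: "real^'n^'m"
  shows "(*v) M \<in> borel_measurable borel"
  by (intro borel_measurable_continuous_onI linear_continuous_on)
     (simp add: linear_conv_bounded_linear[symmetric])

lemma nn_integral_gauss_real:
  assumes "0 < m"
  shows "(\<integral>\<^sup>+x. ennreal (exp (- (1/2) * (m * x\<^sup>2))) \<partial>lborel) = ennreal (sqrt (2 * pi / m))"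
proof -
  have "exp (- (1/2) * (m * x\<^sup>2)) = sqrt (2 * pi / m) * npdf1 0 (1 / m) x" for x :: real
    using assms by (simp add: npdf1_eq)
  then have "(\<integral>\<^sup>+x. ennreal (exp (- (1/2) * (m * x\<^sup>2))) \<partial>lborel)
     = (\<integral>\<^sup>+x. ennreal (sqrt (2 * pi / m)) * ennreal (npdf1 0 (1 / m) x) \<partial>lborel)"
    using assms by (simp add: ennreal_mult)
  also have "\<dots> = ennreal (sqrt (2 * pi / m))"
    using assms by (subst nn_integral_cmult) (auto simp: nn_integral_npdf1)
  finally show ?thesis .
qed

lemma sqrt_prod: "finite A \<Longrightarrow> sqrt (\<Prod>j\<in>A. f j) = (\<Prod>j\<in>A. sqrt (f j))"
  by (induction A rule: finite_induct) (auto simp: real_sqrt_mult)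

lemma gaussian_integral_diagonal:
  fixes M :: "real^'n^'n"
  assumes M: "sym_pos_def M" and diag: "\<And>j k. j \<noteq> k \<Longrightarrow> M $ j $ k = 0"
  shows "0 < det M"
    and "(\<integral>\<^sup>+x. ennreal (exp (- (1/2) * (x \<bullet> (M *v x)))) \<partial>lborel) = ennreal (sqrt ((2 * pi) ^ CARD('n) / det M))"
proof -
  interpret product_sigma_finite "\<lambda>_::'n. lborel :: real measure" by standard
  have pos: "0 < M $ j $ j" for j using sym_pos_def_diag_pos[OF M] .
  have det: "det M = (\<Prod>j\<in>UNIV. M $ j $ j)" using det_diagonal diag by blast
  show "0 < det M" by (simp add: det prod_pos pos)
  have vec: "(\<lambda>z. (\<chi> j. z j) :: real^'n) \<in> borel_measurable (PiM UNIV (\<lambda>_::'n. lborel :: real measure))"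
    by (intro borel_measurable_vec_lambda) simp
  have "x \<bullet> (M *v x) = (\<Sum>j\<in>UNIV. M $ j $ j * (x $ j)\<^sup>2)" for x
  proof -
    have "(M *v x) $ j = M $ j $ j * x $ j" for j
    proof -
      have "(\<Sum>k\<in>UNIV. M $ j $ k * x $ k) = (\<Sum>k\<in>{j}. M $ j $ k * x $ k)"
        by (rule sum.mono_neutral_right) (auto simp: diag)
      then show ?thesis by (simp add: matrix_vector_mult_def)
    qed
    then show ?thesis by (simp add: inner_vec_def power2_eq_square ac_simps)
  qed
  then have "ennreal (exp (- (1/2) * (x \<bullet> (M *v x)))) = (\<Prod>j\<in>UNIV. ennreal (exp (- (1/2) * (M $ j $ j * (x $ j)\<^sup>2))))" for x
    by (simp add: exp_sum[symmetric] prod_ennreal sum_negf sum_divide_distrib)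
  then have "(\<integral>\<^sup>+x. ennreal (exp (- (1/2) * (x \<bullet> (M *v x)))) \<partial>lborel)
    = (\<integral>\<^sup>+x. (\<Prod>j\<in>UNIV. ennreal (exp (- (1/2) * (M $ j $ j * (x $ j)\<^sup>2)))) \<partial>lborel)"
    by simp
  also have "\<dots> = (\<integral>\<^sup>+z. (\<Prod>j\<in>UNIV. ennreal (exp (- (1/2) * (M $ j $ j * (z j)\<^sup>2)))) \<partial>PiM UNIV (\<lambda>_. lborel))"
    using vec by (subst lborel_vec_eq_PiM) (simp add: nn_integral_distr)
  also have "\<dots> = (\<Prod>j\<in>UNIV. \<integral>\<^sup>+x. ennreal (exp (- (1/2) * (M $ j $ j * x\<^sup>2))) \<partial>lborel)"
    by (rule product_nn_integral_prod) auto
  also have "\<dots> = (\<Prod>j\<in>UNIV. ennreal (sqrt (2 * pi / M $ j $ j)))"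
    using nn_integral_gauss_real[OF pos] by simp
  also have "\<dots> = ennreal (\<Prod>j\<in>UNIV. sqrt (2 * pi / M $ j $ j))"
    by (rule prod_ennreal) (simp add: pos less_imp_le)
  also have "(\<Prod>j\<in>UNIV. sqrt (2 * pi / M $ j $ j)) = sqrt ((2 * pi) ^ CARD('n) / det M)"
    by (simp add: sqrt_prod[symmetric] prod_dividef det)
  finally show "(\<integral>\<^sup>+x. ennreal (exp (- (1/2) * (x \<bullet> (M *v x)))) \<partial>lborel) = ennreal (sqrt ((2 * pi) ^ CARD('n) / det M))" .
qed

text \<open>A shear along coordinate $i$ in the direction of the $i$-th column of $M^{-1}$ has determinant $1$ and
  decouples coordinate $i$ from the others; the induction is on the number of coupled coordinates.\<close>

lemma gaussian_integral:
  fixes M :: "real^'n^'n"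
  assumes "sym_pos_def M"
  shows "0 < det M \<and>
    (\<integral>\<^sup>+x. ennreal (exp (- (1/2) * (x \<bullet> (M *v x)))) \<partial>lborel) = ennreal (sqrt ((2 * pi) ^ CARD('n) / det M))"
  using assms
proof (induction "card {k. \<exists>j. j \<noteq> k \<and> M $ k $ j \<noteq> 0}" arbitrary: M rule: less_induct)
  case less
  show ?case
  proof (cases "{k. \<exists>j. j \<noteq> k \<and> M $ k $ j \<noteq> 0} = {}")
    case True
    have "M $ k $ j = 0" if "k \<noteq> j" for j k
    proof -
      have "k \<notin> {k. \<exists>j. j \<noteq> k \<and> M $ k $ j \<noteq> 0}" unfolding True by simp
      then show ?thesis using that by (metis (mono_tags, lifting) mem_Collect_eq)
    qed
    then show ?thesis using gaussian_integral_diagonal[OF less.prems] by simp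
  next
    case False
    then obtain i where i: "\<exists>j. j \<noteq> i \<and> M $ i $ j \<noteq> 0" by auto
    note M = less.prems
    obtain b d where b: "b $ i = 1" "M *v b = d *\<^sub>R axis i 1"
      using sym_pos_def_pivot[OF sym_pos_def_matrix_inv[OF M], of i]
      by (metis matrix_inv_matrix_inv sym_pos_def_invertible[OF M])
    \<comment> \<open>With this choice the shear sends \<open>axis i 1\<close> to \<open>b\<close>
      and fixes the other unit vectors. As \<open>M *v b\<close> is a multiple of
      \<open>axis i 1\<close>, the new row \<open>i\<close> vanishes off the diagonal.\<close>
    define c where "c = b - axis i 1"
    have c: "c $ i = 0" by (simp add: c_def b)
    define M' where "M' = transpose (shear i c) ** M ** shear i c"
    have "invertible (shear i c)" by (simp add: invertible_det_nz det_shear c)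
    then have M': "sym_pos_def M'" unfolding M'_def by (rule sym_pos_def_congruence[OF M])
    have form: "x \<bullet> (M' *v y) = (shear i c *v x) \<bullet> (M *v (shear i c *v y))" for x y
      unfolding M'_def by (metis dot_lmul_matrix inner_commute matrix_vector_mul_assoc transpose_matrix_vector)
    have shear_axis: "shear i c *v axis j 1 = (if j = i then b else axis j 1)" for j
      by (auto simp: shear_mult c_def) (simp add: axis_def)
    have row_i: "M' $ i $ j = 0" if "j \<noteq> i" for j
      using that sym_pos_def_inner_commute[OF M, of b]
      by (simp add: matrix_entry[of M'] form shear_axis b inner_axis_axis)
    have sym: "M' $ j $ k = M' $ k $ j" for j k
      using sym_pos_def_inner_commute[OF M'] by (simp add: matrix_entry[of M'])
    have other: "M' $ j $ k = M $ j $ k" if "j \<noteq> i" "k \<noteq> i" for j k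
      using that by (simp add: matrix_entry[of M'] matrix_entry[of M] form shear_axis)
    \<comment> \<open>Index \<open>i\<close> leaves the set, and none joins it, since entries
      outside row and column \<open>i\<close> are unchanged.\<close>
    have "{k. \<exists>j. j \<noteq> k \<and> M' $ k $ j \<noteq> 0} \<subset> {k. \<exists>j. j \<noteq> k \<and> M $ k $ j \<noteq> 0}"
    proof (rule psubsetI)
      show "{k. \<exists>j. j \<noteq> k \<and> M' $ k $ j \<noteq> 0} \<subseteq> {k. \<exists>j. j \<noteq> k \<and> M $ k $ j \<noteq> 0}"
      proof safe
        fix k j assume "j \<noteq> k" "M' $ k $ j \<noteq> 0"
        moreover from this have "j \<noteq> i" "k \<noteq> i" using row_i sym by metis+
        ultimately show "\<exists>j. j \<noteq> k \<and> M $ k $ j \<noteq> 0" using other by metis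
      qed
      show "{k. \<exists>j. j \<noteq> k \<and> M' $ k $ j \<noteq> 0} \<noteq> {k. \<exists>j. j \<noteq> k \<and> M $ k $ j \<noteq> 0}"
        using i row_i by blast
    qed
    then have "card {k. \<exists>j. j \<noteq> k \<and> M' $ k $ j \<noteq> 0} < card {k. \<exists>j. j \<noteq> k \<and> M $ k $ j \<noteq> 0}"
      by (intro psubset_card_mono) auto
    from less.hyps[OF this M'] have IH: "0 < det M'"
      "(\<integral>\<^sup>+x. ennreal (exp (- (1/2) * (x \<bullet> (M' *v x)))) \<partial>lborel) = ennreal (sqrt ((2 * pi) ^ CARD('n) / det M'))"
      by auto
    have "det M' = det M"
      by (simp add: M'_def det_mul det_transpose det_shear c)
    moreover have "(\<integral>\<^sup>+x. ennreal (exp (- (1/2) * (x \<bullet> (M' *v x)))) \<partial>lborel) =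
      (\<integral>\<^sup>+x. ennreal (exp (- (1/2) * (x \<bullet> (M *v x)))) \<partial>lborel)"
      unfolding form
      by (rule nn_integral_shear[where f="\<lambda>x. ennreal (exp (- (1/2) * (x \<bullet> (M *v x))))", OF _ c]) measurable
    ultimately show ?thesis using IH by simp
  qed
qed

text \<open>The induction that evaluates the Gaussian integral also preserves the determinant down
  to the diagonal case, where it is a product of positive entries.\<close>

lemma sym_pos_def_det_pos: "sym_pos_def M \<Longrightarrow> 0 < det M"
  by (rule gaussian_integral[THEN conjunct1])

section \<open>Multivariate normal densities: total mass, marginals and products\<close>

lemma borel_measurable_mvn_pdf [measurable]: "mvn_pdf a B \<in> borel_measurable borel"
  unfolding mvn_pdf_def[abs_def] by measurable

lemma mvn_pdf_pos: "sym_pos_def B \<Longrightarrow> 0 < mvn_pdf a B m"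
  using sym_pos_def_det_pos[of B] by (simp add: mvn_pdf_def)

lemma continuous_mvn_pdf:
  assumes "sym_pos_def B"
  shows "continuous_on UNIV (mvn_pdf a B)"
proof -
  have "continuous_on UNIV (\<lambda>x. matrix_inv B *v (x - a))"
    by (rule continuous_on_compose2[OF matrix_vector_mult_linear_continuous_on[of UNIV "matrix_inv B"]])
       (auto intro!: continuous_intros)
  then show ?thesis
    using sym_pos_def_det_pos[OF assms] unfolding mvn_pdf_def[abs_def]
    by (intro continuous_intros) auto
qed

lemma nn_integral_mvn_pdf:
  fixes B :: "real^'n^'n"
  assumes B: "sym_pos_def B"
  shows "(\<integral>\<^sup>+x. ennreal (mvn_pdf a B x) \<partial>lborel) = 1"
proof -
  define N where "N = sqrt ((2 * pi) ^ CARD('n) * det B)"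
  have N: "0 < N" using sym_pos_def_det_pos[OF B] by (simp add: N_def)
  have "det (matrix_inv B) * det B = 1"
    by (metis B det_I det_mul matrix_inv_invertible(2) sym_pos_def_invertible)
  then have det: "1 / det (matrix_inv B) = det B"
    by (metis div_by_0 divide_eq_eq mult_zero_left zero_neq_one mult.commute)
  have "(\<integral>\<^sup>+x. ennreal (mvn_pdf a B x) \<partial>lborel) = (\<integral>\<^sup>+x. ennreal (mvn_pdf a B x) \<partial>distr lborel borel ((+) a))"
    by (simp add: lborel_distr_plus)
  also have "\<dots> = (\<integral>\<^sup>+x. ennreal (1 / N) * ennreal (exp (- (1/2) * (x \<bullet> (matrix_inv B *v x)))) \<partial>lborel)"
    using N unfolding mvn_pdf_def N_def[symmetric] by (subst nn_integral_distr) (auto simp: ennreal_mult'[symmetric])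
  also have "\<dots> = ennreal (1 / N) * (\<integral>\<^sup>+x. ennreal (exp (- (1/2) * (x \<bullet> (matrix_inv B *v x)))) \<partial>lborel)"
    by (rule nn_integral_cmult) measurable
  also have "\<dots> = ennreal (1 / N) * ennreal N"
    unfolding gaussian_integral[OF sym_pos_def_matrix_inv[OF B], THEN conjunct2]
    unfolding N_def det[symmetric] by simp
  also have "\<dots> = 1"
    using N by (simp add: ennreal_mult'[symmetric])
  finally show ?thesis .
qed

text \<open>Translating the slice along the pivot direction \<open>b\<close> splits the exponent
  into a term in \<open>t\<close> alone and a term free of \<open>t\<close>, so only a constant
  remains to be identified.\<close>

lemma nn_integral_mvn_pdf_slice:
  fixes B :: "real^'n^'n"
  assumes B: "sym_pos_def B"
  shows "(\<integral>\<^sup>+z. ennreal (mvn_pdf a B (\<chi> j. if j = i then t else z j)) \<partial>PiM (UNIV - {i}) (\<lambda>_. lborel))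
    = ennreal (npdf1 (a $ i) (B $ i $ i) t)"
proof -
  let ?M = "matrix_inv B" and ?v = "B $ i $ i"
  obtain b where b: "b $ i = 1" "?M *v b = (1 / ?v) *\<^sub>R axis i 1"
    using sym_pos_def_pivot[OF B] .
  have v: "0 < ?v" using sym_pos_def_diag_pos[OF B] .
  define g where "g w = exp (- (1/2) * (w \<bullet> (?M *v w))) / sqrt ((2 * pi) ^ CARD('n) * det B)" for w
  have g[measurable]: "g \<in> borel_measurable borel" unfolding g_def[abs_def] by measurable
  \<comment> \<open>The integral over the slice through zero. It is not computed; the total mass of
    the density fixes it below, so no determinant of a submatrix appears.\<close>
  define K where "K = (\<integral>\<^sup>+z. ennreal (g (\<chi> j. if j = i then 0 else z j)) \<partial>PiM (UNIV - {i}) (\<lambda>_. lborel))"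
  have slice: "(\<integral>\<^sup>+z. ennreal (mvn_pdf a B (\<chi> j. if j = i then t else z j)) \<partial>PiM (UNIV - {i}) (\<lambda>_. lborel))
    = ennreal (exp (- (t - a $ i)\<^sup>2 / (2 * ?v))) * K" for t
  proof -
    define s where "s = t - a $ i"
    \<comment> \<open>Here \<open>d $ i = - t\<close>, so this shift carries the slice at
      \<open>t\<close> to the slice at zero.\<close>
    define d where "d = - a - s *\<^sub>R b"
    have "mvn_pdf a B (\<chi> j. if j = i then t else z j) =
      exp (- (t - a $ i)\<^sup>2 / (2 * ?v)) * g ((\<chi> j. if j = i then t else z j) + d)" for z
    proof -
      define w where "w = (\<chi> j. if j = i then t else z j) + d"
      have w: "w $ i = 0" by (simp add: w_def d_def s_def b)
      have "(\<chi> j. if j = i then t else z j) - a = w + s *\<^sub>R b"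
        by (simp add: w_def d_def)
      then have "mvn_pdf a B (\<chi> j. if j = i then t else z j) =
          exp (- (1/2) * (w \<bullet> (?M *v w) + (1 / ?v) * s\<^sup>2)) / sqrt ((2 * pi) ^ CARD('n) * det B)"
        using quadratic_form_split[OF sym_pos_def_matrix_inv[OF B] b w, of s]
        by (simp only: mvn_pdf_def)
      also have "\<dots> = exp (- (t - a $ i)\<^sup>2 / (2 * ?v)) * g w"
        by (simp add: g_def s_def field_simps exp_add[symmetric] exp_diff)
      finally show ?thesis by (simp add: w_def)
    qed
    then have "(\<integral>\<^sup>+z. ennreal (mvn_pdf a B (\<chi> j. if j = i then t else z j)) \<partial>PiM (UNIV - {i}) (\<lambda>_. lborel))
      = ennreal (exp (- (t - a $ i)\<^sup>2 / (2 * ?v))) *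
        (\<integral>\<^sup>+z. ennreal (g ((\<chi> j. if j = i then t else z j) + d)) \<partial>PiM (UNIV - {i}) (\<lambda>_. lborel))"
      by (simp add: ennreal_mult' nn_integral_cmult)
    also have "(\<integral>\<^sup>+z. ennreal (g ((\<chi> j. if j = i then t else z j) + d)) \<partial>PiM (UNIV - {i}) (\<lambda>_. lborel)) = K"
      unfolding K_def
      by (subst nn_integral_slice_translate[where f="\<lambda>x. ennreal (g x)"]) (simp_all add: d_def s_def b cong: if_cong)
    finally show ?thesis .
  qed
  have factor: "exp (- (t - a $ i)\<^sup>2 / (2 * ?v)) = sqrt (2 * pi * ?v) * npdf1 (a $ i) ?v t" for t
    using v by (simp add: npdf1_eq)
  \<comment> \<open>Integrating the slices over \<open>t\<close> must give total mass one, which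
    determines \<open>K\<close>.\<close>
  have "1 = (\<integral>\<^sup>+t. ennreal (exp (- (t - a $ i)\<^sup>2 / (2 * ?v))) * K \<partial>lborel)"
    using nn_integral_mvn_pdf[OF B, of a] by (subst (asm) nn_integral_vec_Fubini[where i=i]) (simp_all add: slice)
  also have "\<dots> = (\<integral>\<^sup>+t. ennreal (npdf1 (a $ i) ?v t) * (ennreal (sqrt (2 * pi * ?v)) * K) \<partial>lborel)"
    using v unfolding factor by (simp add: ennreal_mult ac_simps)
  also have "\<dots> = ennreal (sqrt (2 * pi * ?v)) * K"
    using v by (subst nn_integral_multc) (simp_all add: nn_integral_npdf1)
  finally have K: "ennreal (sqrt (2 * pi * ?v)) * K = 1" by simp
  have "ennreal (sqrt (2 * pi * ?v) * npdf1 (a $ i) ?v t) * K =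
      ennreal (npdf1 (a $ i) ?v t) * (ennreal (sqrt (2 * pi * ?v)) * K)"
    using v by (simp add: ennreal_mult ac_simps)
  then show ?thesis
    unfolding slice factor K by simp
qed


lemma integrable_mvn_pdf: "sym_pos_def B \<Longrightarrow> integrable lborel (mvn_pdf a B)"
  and integral_mvn_pdf: "sym_pos_def B \<Longrightarrow> (\<integral>x. mvn_pdf a B x \<partial>lborel) = 1"
proof -
  assume B: "sym_pos_def B"
  then have nn: "AE x in lborel. 0 \<le> mvn_pdf a B x"
    using mvn_pdf_pos less_imp_le by blast
  show "integrable lborel (mvn_pdf a B)"
    using nn nn_integral_mvn_pdf[OF B, of a] by (intro integrableI_nonneg) auto
  show "(\<integral>x. mvn_pdf a B x \<partial>lborel) = 1"
    using nn nn_integral_mvn_pdf[OF B, of a] by (subst integral_eq_nn_integral) auto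
qed

text \<open>\<open>h\<close> is constant on each slice. It stands for the normal factor as well as
  for the likelihood, so both arguments of the second divergence are covered.\<close>

lemma marg_mvn_pdf:
  assumes B: "sym_pos_def B"
  shows "marg (\<lambda>m. mvn_pdf a B m * h (m $ i)) i t = npdf1 (a $ i) (B $ i $ i) t * h t"
proof -
  have "marg (\<lambda>m. mvn_pdf a B m * h (m $ i)) i t =
    (\<integral>z. mvn_pdf a B (\<chi> j. if j = i then t else z j) \<partial>PiM (UNIV - {i}) (\<lambda>_. lborel)) * h t"
    by (simp add: marg_def)
  also have "(\<integral>z. mvn_pdf a B (\<chi> j. if j = i then t else z j) \<partial>PiM (UNIV - {i}) (\<lambda>_. lborel))
    = npdf1 (a $ i) (B $ i $ i) t"
    using mvn_pdf_pos[OF B] by (subst integral_eq_nn_integral) (auto simp: nn_integral_mvn_pdf_slice[OF B] less_imp_le)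
  finally show ?thesis .
qed

lemma distr_mvn_pdf_coord:
  fixes B :: "real^'n^'n"
  assumes B: "sym_pos_def B"
  shows "distr (density lborel (mvn_pdf a B)) borel (\<lambda>m. m $ i) = density lborel (npdf1 (a $ i) (B $ i $ i))"
proof (rule measure_eqI)
  fix A assume "A \<in> sets (distr (density lborel (mvn_pdf a B)) borel (\<lambda>m. m $ i))"
  then have A[measurable]: "A \<in> sets borel" by simp
  have "emeasure (distr (density lborel (mvn_pdf a B)) borel (\<lambda>m. m $ i)) A =
    (\<integral>\<^sup>+m. ennreal (mvn_pdf a B m) * indicator A (m $ i) \<partial>lborel)"
  proof -
    have "(\<lambda>m::real^'n. m $ i) -` A \<in> sets borel"
      using measurable_sets_borel[OF _ A, of "\<lambda>m::real^'n. m $ i"] by simp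
    then show ?thesis
      by (subst emeasure_distr) (auto simp: emeasure_density indicator_def intro!: nn_integral_cong)
  qed
  also have "\<dots> = (\<integral>\<^sup>+t. (\<integral>\<^sup>+z. ennreal (mvn_pdf a B (\<chi> j. if j = i then t else z j)) \<partial>PiM (UNIV - {i}) (\<lambda>_. lborel)) * indicator A t \<partial>lborel)"
    by (subst nn_integral_vec_Fubini[where i=i]) (auto simp: nn_integral_multc)
  also have "\<dots> = emeasure (density lborel (npdf1 (a $ i) (B $ i $ i))) A"
    by (simp add: nn_integral_mvn_pdf_slice[OF B] emeasure_density)
  finally show "emeasure (distr (density lborel (mvn_pdf a B)) borel (\<lambda>m. m $ i)) A =
    emeasure (density lborel (npdf1 (a $ i) (B $ i $ i))) A" .
qed simp

text \<open>Change of variables to the law of coordinate \<open>i\<close>. Integrability is stated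
  as an equivalence so that finiteness of \<open>KL\<close> can be transferred too.\<close>

lemma
  fixes h :: "real \<Rightarrow> real"
  assumes B: "sym_pos_def B" and h[measurable]: "h \<in> borel_measurable borel"
  shows integrable_mvn_pdf_coord: "integrable lborel (\<lambda>m. mvn_pdf a B m * h (m $ i)) \<longleftrightarrow>
      integrable lborel (\<lambda>t. npdf1 (a $ i) (B $ i $ i) t * h t)" (is ?int)
    and integral_mvn_pdf_coord: "(\<integral>m. mvn_pdf a B m * h (m $ i) \<partial>lborel) =
      (\<integral>t. npdf1 (a $ i) (B $ i $ i) t * h t \<partial>lborel)" (is ?eq)
proof -
  have pos: "AE x in lborel. 0 \<le> mvn_pdf a B x"
    using mvn_pdf_pos[OF B] less_imp_le by blast
  let ?D = "density lborel (\<lambda>m. ennreal (mvn_pdf a B m))"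
  have "integrable lborel (\<lambda>m. mvn_pdf a B m * h (m $ i)) \<longleftrightarrow> integrable ?D (\<lambda>m. h (m $ i))"
    using pos by (subst integrable_density) auto
  also have "\<dots> \<longleftrightarrow> integrable (distr ?D borel (\<lambda>m. m $ i)) h"
    by (subst integrable_distr_eq) auto
  also have "\<dots> \<longleftrightarrow> integrable lborel (\<lambda>t. npdf1 (a $ i) (B $ i $ i) t * h t)"
    unfolding distr_mvn_pdf_coord[OF B] by (subst integrable_density) auto
  finally show ?int .
  have "(\<integral>m. mvn_pdf a B m * h (m $ i) \<partial>lborel) = (\<integral>m. h (m $ i) \<partial>?D)"
    using pos by (subst integral_density) auto
  also have "\<dots> = (\<integral>t. h t \<partial>distr ?D borel (\<lambda>m. m $ i))"
    by (subst integral_distr) auto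
  also have "\<dots> = (\<integral>t. npdf1 (a $ i) (B $ i $ i) t * h t \<partial>lborel)"
    unfolding distr_mvn_pdf_coord[OF B] by (subst integral_density) auto
  finally show ?eq .
qed

text \<open>Completing the square: precisions add, and the new mean is the precision-weighted mean.
  The factor \<open>K\<close> is the normal density of \<open>a - b\<close> with variance
  \<open>v + w\<close>; only its positivity is used later.\<close>

lemma npdf1_mult_npdf1:
  assumes "0 < v" "0 < w"
  obtains K where "0 < K"
    "\<And>t. npdf1 a v t * npdf1 b w t = K * npdf1 ((a * w + b * v) / (v + w)) (v * w / (v + w)) t"
proof
  define c u where "c = (a * w + b * v) / (v + w)" and "u = v * w / (v + w)"
  define K where "K = exp (- (a - b)\<^sup>2 / (2 * (v + w))) * sqrt (2 * pi * u) / (sqrt (2 * pi * v) * sqrt (2 * pi * w))"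
  have u: "0 < u" using assms by (simp add: u_def)
  then show "0 < K" using assms by (simp add: K_def)
  fix t
  have "- (t - a)\<^sup>2 / (2 * v) + - (t - b)\<^sup>2 / (2 * w) = - (a - b)\<^sup>2 / (2 * (v + w)) + - (t - c)\<^sup>2 / (2 * u)"
  proof -
    have nz: "v \<noteq> 0" "w \<noteq> 0" "v + w \<noteq> 0" using assms by auto
    have tc: "t - c = ((t - a) * w + (t - b) * v) / (v + w)"
      using nz by (simp add: c_def field_simps)
    have "(t - c)\<^sup>2 / u = ((t - a) * w + (t - b) * v)\<^sup>2 / ((v + w) * v * w)"
      using nz unfolding tc u_def by (simp add: power_divide power2_eq_square)
    moreover have "(t - a)\<^sup>2 / v + (t - b)\<^sup>2 / w =
       ((t - a) - (t - b))\<^sup>2 / (v + w) + ((t - a) * w + (t - b) * v)\<^sup>2 / ((v + w) * v * w)"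
      using nz by (simp add: divide_simps) algebra
    ultimately have "(t - a)\<^sup>2 / v + (t - b)\<^sup>2 / w = (a - b)\<^sup>2 / (v + w) + (t - c)\<^sup>2 / u"
      by (simp add: power2_commute)
    then have "((t - a)\<^sup>2 / v + (t - b)\<^sup>2 / w) / 2 = ((a - b)\<^sup>2 / (v + w) + (t - c)\<^sup>2 / u) / 2" by simp
    then show ?thesis by (simp add: add_divide_distrib mult.commute)
  qed
  then show "npdf1 a v t * npdf1 b w t = K * npdf1 c u t"
    using assms u by (simp add: npdf1_eq K_def exp_add[symmetric] mult_exp_exp)
qed

text \<open>The extra factor adds \<open>1 / v\<close> to diagonal entry \<open>i\<close> of the
  precision matrix, which stays positive definite; completing the square then gives the new
  mean.\<close>

lemma mvn_pdf_mult_npdf1: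
  fixes S :: "real^'n^'n"
  assumes S: "sym_pos_def S" and v: "0 < v"
  obtains a' S' K where "sym_pos_def S'" "0 < K"
    "\<And>m. mvn_pdf a S m * npdf1 b v (m $ i) = K * mvn_pdf a' S' m"
proof
  define P where "P = matrix_inv S"
  define E :: "real^'n^'n" where "E = (\<chi> j k. if j = i \<and> k = i then 1 / v else 0)"
  define P' where "P' = P + E"
  have E: "E *v x = (x $ i / v) *\<^sub>R axis i 1" for x
  proof -
    have "(E *v x) $ j = ((x $ i / v) *\<^sub>R axis i 1) $ j" for j
      by (cases "j = i") (simp_all add: E_def matrix_vector_mult_def axis_def if_distrib[of "\<lambda>u. u * _"] cong: if_cong)
    then show ?thesis by (simp add: vec_eq_iff)
  qed
  have P: "sym_pos_def P" unfolding P_def by (rule sym_pos_def_matrix_inv[OF S])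
  have form: "x \<bullet> (P' *v y) = x \<bullet> (P *v y) + x $ i * y $ i / v" for x y
    by (simp add: P'_def matrix_vector_mult_add_rdistrib inner_add_right E inner_axis)
  have P': "sym_pos_def P'"
  proof -
    have "transpose P' = P'"
      using P by (simp add: sym_pos_def_def P'_def E_def vec_eq_iff transpose_def conj_commute)
    moreover have "0 < x \<bullet> (P' *v x)" if "x \<noteq> 0" for x
      using P that v unfolding form sym_pos_def_def by (simp add: add_pos_nonneg)
    ultimately show ?thesis by (simp add: sym_pos_def_def)
  qed
  define S' where "S' = matrix_inv P'"
  define a' where "a' = S' *v (P *v a + (b / v) *\<^sub>R axis i 1)"
  show S': "sym_pos_def S'" unfolding S'_def by (rule sym_pos_def_matrix_inv[OF P'])
  have inv: "matrix_inv S' = P'"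
    unfolding S'_def by (rule matrix_inv_matrix_inv[OF sym_pos_def_invertible[OF P']])
  have a': "P' *v a' = P *v a + (b / v) *\<^sub>R axis i 1"
    by (simp add: a'_def S'_def matrix_vector_mul_assoc matrix_inv_invertible(1)[OF sym_pos_def_invertible[OF P']])
  \<comment> \<open>The part of the exponent that does not depend on \<open>m\<close> after
    completing the square; it is absorbed into \<open>K\<close>.\<close>
  define c where "c = a \<bullet> (P *v a) + b\<^sup>2 / v - a' \<bullet> (P' *v a')"
  have square: "(m - a) \<bullet> (P *v (m - a)) + (m $ i - b)\<^sup>2 / v = (m - a') \<bullet> (P' *v (m - a')) + c" for m
  proof -
    have "(m - a) \<bullet> (P *v (m - a)) = m \<bullet> (P *v m) - 2 * (m \<bullet> (P *v a)) + a \<bullet> (P *v a)"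
      using sym_pos_def_inner_commute[OF P, of a m]
      by (simp add: matrix_vector_mult_diff_distrib inner_diff_left inner_diff_right)
    moreover have "(m - a') \<bullet> (P' *v (m - a')) = m \<bullet> (P' *v m) - 2 * (m \<bullet> (P' *v a')) + a' \<bullet> (P' *v a')"
      using sym_pos_def_inner_commute[OF P', of a' m]
      by (simp add: matrix_vector_mult_diff_distrib inner_diff_left inner_diff_right)
    moreover have "m \<bullet> (P' *v m) = m \<bullet> (P *v m) + (m $ i)\<^sup>2 / v"
      by (simp add: form power2_eq_square)
    moreover have "m \<bullet> (P' *v a') = m \<bullet> (P *v a) + b * m $ i / v"
      by (simp add: a' inner_add_right inner_axis)
    ultimately show ?thesis
      by (simp add: c_def power2_diff diff_divide_distrib add_divide_distrib)
  qed
  define N N' where "N = sqrt ((2 * pi) ^ CARD('n) * det S)" and "N' = sqrt ((2 * pi) ^ CARD('n) * det S')"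
  have N: "0 < N" "0 < N'"
    using sym_pos_def_det_pos[OF S] sym_pos_def_det_pos[OF S'] by (simp_all add: N_def N'_def)
  define K where "K = exp (- c / 2) * N' / (N * sqrt (2 * pi * v))"
  show "0 < K" using N v by (simp add: K_def)
  fix m
  have "mvn_pdf a S m * npdf1 b v (m $ i) =
     exp (- (1/2) * ((m - a) \<bullet> (P *v (m - a)) + (m $ i - b)\<^sup>2 / v)) / (N * sqrt (2 * pi * v))"
    using v by (simp add: npdf1_eq mvn_pdf_def P_def N_def exp_add[symmetric] mult_exp_exp add_divide_distrib mult.commute)
  also have "\<dots> = exp (- (1/2) * ((m - a') \<bullet> (P' *v (m - a')))) * exp (- c / 2) / (N * sqrt (2 * pi * v))"
    unfolding square by (simp add: mult_exp_exp add_divide_distrib)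
  also have "\<dots> = K * mvn_pdf a' S' m"
    using N unfolding mvn_pdf_def inv N'_def[symmetric] by (simp add: K_def)
  finally show "mvn_pdf a S m * npdf1 b v (m $ i) = K * mvn_pdf a' S' m" .
qed

subsection \<open>The standard normal distribution function\<close>

lemma std_normal_density_has_real_derivative:
  "(std_normal_density has_real_derivative - (x * std_normal_density x)) (at x)"
proof -
  have "((\<lambda>x. c * exp (- x\<^sup>2 / 2)) has_real_derivative - (x * (c * exp (- x\<^sup>2 / 2)))) (at x)" for c
    by (auto intro!: derivative_eq_intros)
  then show ?thesis unfolding std_normal_density_def[abs_def] .
qed

lemma set_integrable_std_normal_density:
  "A \<in> sets borel \<Longrightarrow> set_integrable lborel A std_normal_density"
  unfolding set_integrable_def by (rule integrable_mult_indicator) auto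

lemma Phi_nonneg: "0 \<le> Phi x"
  unfolding Phi_def set_lebesgue_integral_def by (rule integral_nonneg_AE) simp

lemma Phi_le_1: "Phi x \<le> 1"
proof -
  have "Phi x \<le> (\<integral>u. std_normal_density u \<partial>lborel)"
    unfolding Phi_def set_lebesgue_integral_def
    using set_integrable_std_normal_density[of "{..x}"]
    by (intro integral_mono) (auto simp: set_integrable_def indicator_def)
  then show ?thesis by simp
qed

lemma Phi_has_real_derivative: "(Phi has_real_derivative std_normal_density x) (at x)"
proof -
  \<comment> \<open>Any base point left of \<open>x\<close> would do: the tail up to
    \<open>a\<close> becomes a constant, and the fundamental theorem applies on a compact interval
    around \<open>x\<close>.\<close>
  define a where "a = x - 1"
  have eq: "Phi t = Phi a + integral {a..t} std_normal_density" if "a \<le> t" for t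
  proof -
    have "{..t} = {..a} \<union> {a<..t}" using that by auto
    then have "Phi t = Phi a + (LINT u:{a<..t}|lborel. std_normal_density u)"
      unfolding Phi_def by (subst set_integral_Un[symmetric])
        (auto intro!: set_integrable_std_normal_density)
    also have "(LINT u:{a<..t}|lborel. std_normal_density u) = (LINT u:{a..t}|lborel. std_normal_density u)"
    proof (rule set_integral_null_delta)
      have "({a<..t} - {a..t}) \<union> ({a..t} - {a<..t}) = {a}" using that by auto
      then show "({a<..t} - {a..t}) \<union> ({a..t} - {a<..t}) \<in> null_sets lborel"
        by (auto intro!: finite_imp_null_set_lborel)
    qed auto
    also have "\<dots> = integral {a..t} std_normal_density"
      by (rule set_borel_integral_eq_integral(2)) (auto intro: set_integrable_std_normal_density)
    finally show ?thesis .
  qed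
  have "((\<lambda>t. integral {a..t} std_normal_density) has_real_derivative std_normal_density x) (at x within {a..x+1})"
    by (rule integral_has_real_derivative) (auto simp: a_def std_normal_density_def intro!: continuous_intros)
  then have "((\<lambda>t. integral {a..t} std_normal_density) has_real_derivative std_normal_density x) (at x)"
    by (simp add: a_def at_within_Icc_at)
  then have "((\<lambda>t. Phi a + integral {a..t} std_normal_density) has_real_derivative std_normal_density x) (at x)"
    by (auto intro!: derivative_eq_intros)
  moreover have "eventually (\<lambda>t. Phi t = Phi a + integral {a..t} std_normal_density) (nhds x)"
  proof -
    have "eventually (\<lambda>t. t \<in> {a<..}) (nhds x)"
      by (rule eventually_nhds_in_open) (auto simp: a_def)
    then show ?thesis by eventually_elim (auto intro: eq)
  qed
  ultimately show ?thesis
    by (subst DERIV_cong_ev[OF refl _ refl]) 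
qed

lemma continuous_on_Phi [continuous_intros]:
  "continuous_on S f \<Longrightarrow> continuous_on S (\<lambda>x. Phi (f x))"
  using DERIV_continuous[OF Phi_has_real_derivative]
  by (intro continuous_on_compose2[of UNIV Phi S f] continuous_at_imp_continuous_on) auto

lemma borel_measurable_Phi [measurable]: "Phi \<in> borel_measurable borel"
  by (intro borel_measurable_continuous_onI continuous_intros)

text \<open>By the mean value theorem on an interval of length one, \<open>Phi x\<close> is at least
  the density at a point of modulus at most \<open>\<bar>x\<bar> + 1\<close>. This crude bound makes
  \<open>ln (Phi x)\<close> grow at most quadratically, hence integrable against a normal
  density.\<close>

lemma Phi_lower_bound: "exp (- (\<bar>x\<bar> + 1)\<^sup>2 / 2) / sqrt (2 * pi) \<le> Phi x"
proof -
  obtain z where z: "x - 1 < z" "z < x" "Phi x - Phi (x - 1) = (x - (x - 1)) * std_normal_density z"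
    using MVT2[of "x - 1" x Phi std_normal_density] Phi_has_real_derivative by auto
  have "z\<^sup>2 \<le> (\<bar>x\<bar> + 1)\<^sup>2"
    using z by (intro abs_le_square_iff[THEN iffD1]) auto
  then have "exp (- (\<bar>x\<bar> + 1)\<^sup>2 / 2) / sqrt (2 * pi) \<le> std_normal_density z"
    by (simp add: std_normal_density_def divide_right_mono)
  then show ?thesis using z Phi_nonneg[of "x - 1"] by simp
qed

lemma Phi_pos: "0 < Phi x"
  by (rule less_le_trans[OF _ Phi_lower_bound]) simp

lemma abs_ln_Phi_le: "\<bar>ln (Phi x)\<bar> \<le> (\<bar>x\<bar> + 1)\<^sup>2 / 2 + ln (sqrt (2 * pi))"
proof -
  have "ln (exp (- (\<bar>x\<bar> + 1)\<^sup>2 / 2) / sqrt (2 * pi)) \<le> ln (Phi x)"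
    using Phi_lower_bound[of x] by (intro ln_mono) (auto simp: Phi_pos)
  moreover have "ln (exp (- (\<bar>x\<bar> + 1)\<^sup>2 / 2) / sqrt (2 * pi)) = - ((\<bar>x\<bar> + 1)\<^sup>2 / 2 + ln (sqrt (2 * pi)))"
    by (subst ln_div) auto
  moreover have "ln (Phi x) \<le> 0"
    using Phi_le_1[of x] Phi_pos[of x] by simp
  ultimately show ?thesis by simp
qed

text \<open>For negative \<open>x\<close> put \<open>a = - x\<close>: on the tail beyond
  \<open>a\<close> the factor \<open>a\<close> is at most \<open>u\<close>, and
  \<open>u * std_normal_density u\<close> has the antiderivative
  \<open>- std_normal_density u\<close>.\<close>

lemma Phi_Mills_ratio: "0 \<le> x * Phi x + std_normal_density x"
proof (cases "0 \<le> x")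
  case True
  then show ?thesis using Phi_nonneg by simp
next
  case False
  define a where "a = - x"
  have a: "0 < a" using False by (simp add: a_def)
  have "ennreal (Phi x) = (\<integral>\<^sup>+u. ennreal (std_normal_density u) * indicator {..x} u \<partial>lborel)"
    unfolding Phi_def set_lebesgue_integral_def
    using set_integrable_std_normal_density[of "{..x}"]
    by (subst nn_integral_eq_integral[symmetric])
       (auto simp: set_integrable_def indicator_def intro!: nn_integral_cong)
  also have "\<dots> = (\<integral>\<^sup>+u. ennreal (std_normal_density u) * indicator {a..} u \<partial>lborel)"
    by (subst nn_integral_real_affine[where c="-1" and t=0])
       (auto simp: std_normal_density_def a_def indicator_def intro!: nn_integral_cong)
  finally have Phi: "ennreal (Phi x) = (\<integral>\<^sup>+u. ennreal (std_normal_density u) * indicator {a..} u \<partial>lborel)" .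
  have "ennreal (a * Phi x) = (\<integral>\<^sup>+u. ennreal a * (ennreal (std_normal_density u) * indicator {a..} u) \<partial>lborel)"
    using a by (subst nn_integral_cmult) (auto simp: Phi ennreal_mult Phi_nonneg)
  also have "\<dots> \<le> (\<integral>\<^sup>+u. ennreal (u * std_normal_density u) * indicator {a..} u \<partial>lborel)"
    using a by (intro nn_integral_mono) (auto simp: indicator_def ennreal_mult'[symmetric] intro!: mult_right_mono)
  also have "\<dots> = ennreal (0 - (- std_normal_density a))"
  proof (rule nn_integral_FTC_atLeast)
    show "((\<lambda>u. - std_normal_density u) \<longlongrightarrow> 0) at_top"
      unfolding std_normal_density_def by real_asymp
    fix u assume "a \<le> u"
    then show "0 \<le> u * std_normal_density u" using a by simp
    show "((\<lambda>u. - std_normal_density u) has_real_derivative u * std_normal_density u) (at u)"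
      by (auto intro!: derivative_eq_intros std_normal_density_has_real_derivative)
  qed auto
  finally have "a * Phi x \<le> std_normal_density a"
    by (simp add: ennreal_le_iff)
  then show ?thesis by (simp add: a_def std_normal_density_def)
qed

text \<open>The sign of the second derivative is that of
  \<open>x * Phi x + std_normal_density x\<close>, which is the Mills ratio bound.\<close>

lemma convex_on_neg_ln_Phi: "convex_on UNIV (\<lambda>x. - ln (Phi x))"
proof (rule f''_ge0_imp_convex)
  fix x :: real
  show "((\<lambda>x. - ln (Phi x)) has_real_derivative - (std_normal_density x / Phi x)) (at x)"
    using Phi_pos[of x] by (auto intro!: derivative_eq_intros Phi_has_real_derivative)
  have "((\<lambda>x. - (std_normal_density x / Phi x)) has_real_derivative
      - ((- (x * std_normal_density x) * Phi x - std_normal_density x * std_normal_density x) / (Phi x * Phi x))) (at x)"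
    using Phi_pos[of x]
    by (intro DERIV_minus DERIV_divide Phi_has_real_derivative std_normal_density_has_real_derivative) simp
  also have "- ((- (x * std_normal_density x) * Phi x - std_normal_density x * std_normal_density x) / (Phi x * Phi x)) =
      std_normal_density x * (x * Phi x + std_normal_density x) / (Phi x)\<^sup>2"
    unfolding minus_divide_left by (simp add: power2_eq_square algebra_simps)
  finally show "((\<lambda>x. - (std_normal_density x / Phi x)) has_real_derivative
      std_normal_density x * (x * Phi x + std_normal_density x) / (Phi x)\<^sup>2) (at x)" .
  show "0 \<le> std_normal_density x * (x * Phi x + std_normal_density x) / (Phi x)\<^sup>2"
    using Phi_Mills_ratio[of x] by simp
qed auto


subsection \<open>Strict convexity of the one-dimensional divergence\<close>

text \<open>Up to an additive constant, the divergence of $\mathcal{N}(a, s^2)$ from the density proportional to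
  $\phi(t; \mu, w)\,\Phi(y t)$ is the expectation of \<open>probit_loss\<close> at a standard normal $z$, after the
  substitution $t = a + s z$. In the coordinates $(a, s)$ the integrand is strictly convex.\<close>

definition probit_loss :: "real \<Rightarrow> real \<Rightarrow> real \<Rightarrow> real \<Rightarrow> real \<Rightarrow> real \<Rightarrow> real" where
  "probit_loss y \<mu> w a s z = (a + s * z - \<mu>)\<^sup>2 / (2 * w) - ln (Phi (y * (a + s * z))) - ln s - z\<^sup>2 / 2"

definition probit_risk :: "real \<Rightarrow> real \<Rightarrow> real \<Rightarrow> real \<Rightarrow> real \<Rightarrow> real" where
  "probit_risk y \<mu> w a s = (\<integral>z. std_normal_density z * probit_loss y \<mu> w a s z \<partial>lborel)"

lemma integrable_probit_loss:
  "integrable lborel (\<lambda>z. std_normal_density z * probit_loss y \<mu> w a s z)"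
proof -
  define C where "C = ln (sqrt (2 * pi))"
  have C: "0 \<le> C" using pi_gt3 by (simp add: C_def)
  have poly: "integrable lborel (\<lambda>z. std_normal_density z * (p + q * z + r * z\<^sup>2))" for p q r
  proof -
    have "integrable lborel (\<lambda>z. p * (std_normal_density z * z ^ 0) + q * (std_normal_density z * z ^ 1) + r * (std_normal_density z * z ^ 2))"
      by (intro Bochner_Integration.integrable_add integrable_mult_right integrable_std_normal_moment)
    then show ?thesis by (simp add: algebra_simps)
  qed
  have "integrable lborel (\<lambda>z. std_normal_density z * ln (Phi (y * (a + s * z))))"
  proof (rule Bochner_Integration.integrable_bound)
    \<comment> \<open>The coefficients come from
      \<open>(\<bar>x\<bar> + 1)\<^sup>2 / 2 \<le> x\<^sup>2 + 1\<close> and \<open>(a + s *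
      z)\<^sup>2 \<le> 2 * a\<^sup>2 + 2 * (s * z)\<^sup>2\<close>; the term \<open>0 * z\<close>
      only matches the shape of \<open>poly\<close>.\<close>
    show "integrable lborel (\<lambda>z. std_normal_density z * ((2 * y\<^sup>2 * a\<^sup>2 + 1 + C) + 0 * z + (2 * y\<^sup>2 * s\<^sup>2) * z\<^sup>2))"
      by (rule poly)
    show "AE z in lborel. norm (std_normal_density z * ln (Phi (y * (a + s * z))))
      \<le> norm (std_normal_density z * ((2 * y\<^sup>2 * a\<^sup>2 + 1 + C) + 0 * z + (2 * y\<^sup>2 * s\<^sup>2) * z\<^sup>2))"
    proof (rule AE_I2)
      fix z :: real
      let ?x = "y * (a + s * z)"
      have "(\<bar>?x\<bar> + 1)\<^sup>2 / 2 \<le> ?x\<^sup>2 + 1"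
        using zero_le_power2[of "\<bar>?x\<bar> - 1"] by (simp add: power2_eq_square algebra_simps abs_mult_self_eq)
      also have "?x\<^sup>2 \<le> y\<^sup>2 * (2 * a\<^sup>2 + 2 * (s * z)\<^sup>2)"
      proof -
        have "(a + s * z)\<^sup>2 \<le> 2 * a\<^sup>2 + 2 * (s * z)\<^sup>2"
          using zero_le_power2[of "a - s * z"] by (simp add: power2_eq_square algebra_simps)
        then show ?thesis by (simp add: power_mult_distrib mult_left_mono)
      qed
      finally have "\<bar>ln (Phi ?x)\<bar> \<le> (2 * y\<^sup>2 * a\<^sup>2 + 1 + C) + 0 * z + (2 * y\<^sup>2 * s\<^sup>2) * z\<^sup>2"
        using abs_ln_Phi_le[of ?x] by (simp add: C_def algebra_simps power_mult_distrib)
      then show "norm (std_normal_density z * ln (Phi ?x))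
          \<le> norm (std_normal_density z * ((2 * y\<^sup>2 * a\<^sup>2 + 1 + C) + 0 * z + (2 * y\<^sup>2 * s\<^sup>2) * z\<^sup>2))"
        using abs_ge_self order_trans unfolding real_norm_def abs_mult by (blast intro: mult_left_mono abs_ge_zero)
    qed
  qed measurable
  then have "integrable lborel (\<lambda>z. std_normal_density z * (((a - \<mu>)\<^sup>2 / (2 * w) - ln s) + (2 * (a - \<mu>) * s / (2 * w)) * z
      + (s\<^sup>2 / (2 * w) - 1 / 2) * z\<^sup>2) - std_normal_density z * ln (Phi (y * (a + s * z))))"
    by (intro Bochner_Integration.integrable_diff poly)
  moreover have "probit_loss y \<mu> w a s z = (((a - \<mu>)\<^sup>2 / (2 * w) - ln s) + (2 * (a - \<mu>) * s / (2 * w)) * z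
      + (s\<^sup>2 / (2 * w) - 1 / 2) * z\<^sup>2) - ln (Phi (y * (a + s * z)))" for z
  proof -
    have "(a + s * z - \<mu>)\<^sup>2 = (a - \<mu>)\<^sup>2 + 2 * (a - \<mu>) * s * z + s\<^sup>2 * z\<^sup>2"
      by (simp add: power2_eq_square algebra_simps)
    then show ?thesis
      unfolding probit_loss_def by (simp only:) (simp add: add_divide_distrib diff_divide_distrib algebra_simps)
  qed
  ultimately show ?thesis by (simp add: right_diff_distrib)
qed

text \<open>Compare with the tangent of \<open>ln\<close> at the weighted mean \<open>m\<close>: the
  linear terms cancel on averaging, and the tangent bound is strict at \<open>x\<close> unless
  \<open>x = m\<close>.\<close>

lemma ln_convex_combination:
  fixes x y :: real
  assumes "0 < x" "0 < y" "0 < l" "l < 1"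
  shows "(1 - l) * ln x + l * ln y \<le> ln ((1 - l) * x + l * y)" (is ?le)
    and "x \<noteq> y \<Longrightarrow> (1 - l) * ln x + l * ln y < ln ((1 - l) * x + l * y)" (is "_ \<Longrightarrow> ?less")
proof -
  define m where "m = (1 - l) * x + l * y"
  have m: "0 < m" using assms by (simp add: m_def add_pos_pos)
  have x: "ln x - ln m \<le> x / m - 1" and y: "ln y - ln m \<le> y / m - 1"
    using ln_le_minus_one[of "x / m"] ln_le_minus_one[of "y / m"] m assms by (auto simp: ln_div)
  have sum: "(1 - l) * (x / m - 1) + l * (y / m - 1) = 0"
    using m by (simp add: m_def field_simps)
  have x': "(1 - l) * (ln x - ln m) \<le> (1 - l) * (x / m - 1)" and y': "l * (ln y - ln m) \<le> l * (y / m - 1)"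
    using assms x y by (auto intro: mult_left_mono)
  have *: "(1 - l) * ln x + l * ln y = ln m + ((1 - l) * (ln x - ln m) + l * (ln y - ln m))"
    by (simp add: algebra_simps)
  show ?le unfolding m_def[symmetric] * using x' y' sum by linarith
  assume "x \<noteq> y"
  then have "l * (y - x) \<noteq> 0" using assms by simp
  then have "x / m \<noteq> 1" using m by (simp add: m_def algebra_simps)
  then have "ln x - ln m \<noteq> x / m - 1"
    using ln_eq_minus_one[of "x / m"] m assms by (auto simp: ln_div)
  then have "(1 - l) * (ln x - ln m) < (1 - l) * (x / m - 1)"
    using x assms by simp
  then show ?less unfolding m_def[symmetric] * using y' sum by linarith
qed

text \<open>Strictness has two sources: \<open>- ln s\<close> when the scales differ, and the square
  when they agree, since then the means differ and so do the points \<open>t\<close> and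
  \<open>t'\<close>. Thus it holds for every \<open>z\<close>, and integration keeps it.\<close>

lemma probit_loss_strictly_convex:
  assumes w: "0 < w" and s: "0 < s" "0 < s'" and ne: "(a, s) \<noteq> (a', s')" and l: "0 < l" "l < 1"
  shows "probit_loss y \<mu> w ((1 - l) * a + l * a') ((1 - l) * s + l * s') z
    < (1 - l) * probit_loss y \<mu> w a s z + l * probit_loss y \<mu> w a' s' z"
proof -
  define t t' where "t = a + s * z" and "t' = a' + s' * z"
  have mid: "((1 - l) * a + l * a') + ((1 - l) * s + l * s') * z = (1 - l) * t + l * t'"
    by (simp add: t_def t'_def algebra_simps)
  have Phi: "- ln (Phi (y * ((1 - l) * t + l * t'))) \<le> (1 - l) * (- ln (Phi (y * t))) + l * (- ln (Phi (y * t')))"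
    using convex_onD[OF convex_on_neg_ln_Phi, of l "y * t" "y * t'"] l by (simp add: algebra_simps)
  have ln: "(1 - l) * ln s + l * ln s' \<le> ln ((1 - l) * s + l * s')"
    using ln_convex_combination(1) s l by blast
  have quad: "(1 - l) * (t - \<mu>)\<^sup>2 / (2 * w) + l * (t' - \<mu>)\<^sup>2 / (2 * w) - ((1 - l) * t + l * t' - \<mu>)\<^sup>2 / (2 * w)
     = l * (1 - l) * (t - t')\<^sup>2 / (2 * w)"
    unfolding add_divide_distrib[symmetric] diff_divide_distrib[symmetric]
    by (rule arg_cong[where f="\<lambda>u. u / (2 * w)"]) (simp add: power2_eq_square algebra_simps)
  have quad0: "0 \<le> l * (1 - l) * (t - t')\<^sup>2 / (2 * w)" using l w by simp
  have strict: "0 < l * (1 - l) * (t - t')\<^sup>2 / (2 * w) \<or> (1 - l) * ln s + l * ln s' < ln ((1 - l) * s + l * s')"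
  proof (cases "s = s'")
    case True
    then have "t \<noteq> t'" using ne by (simp add: t_def t'_def)
    then show ?thesis using l w by simp
  next
    case False
    then show ?thesis using ln_convex_combination(2) s l by blast
  qed
  have regroup: "(1 - l) * (A - P - Q - R) + l * (A' - P' - Q' - R) =
      (1 - l) * A + l * A' + ((1 - l) * (- P) + l * (- P')) - ((1 - l) * Q + l * Q') - R" for A A' P P' Q Q' R :: real
    by (simp add: algebra_simps)
  have "(1 - l) * probit_loss y \<mu> w a s z + l * probit_loss y \<mu> w a' s' z =
      (1 - l) * (t - \<mu>)\<^sup>2 / (2 * w) + l * (t' - \<mu>)\<^sup>2 / (2 * w)
      + ((1 - l) * (- ln (Phi (y * t))) + l * (- ln (Phi (y * t'))))
      - ((1 - l) * ln s + l * ln s') - z\<^sup>2 / 2"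
    unfolding probit_loss_def t_def[symmetric] t'_def[symmetric] regroup by simp
  moreover have "probit_loss y \<mu> w ((1 - l) * a + l * a') ((1 - l) * s + l * s') z =
     ((1 - l) * t + l * t' - \<mu>)\<^sup>2 / (2 * w) - ln (Phi (y * ((1 - l) * t + l * t'))) - ln ((1 - l) * s + l * s') - z\<^sup>2 / 2"
    unfolding probit_loss_def mid ..
  ultimately show ?thesis using Phi ln quad quad0 strict by linarith
qed

lemma integral_lborel_pos:
  fixes f :: "'a::euclidean_space \<Rightarrow> real"
  assumes int: "integrable lborel f" and pos: "\<And>x. 0 < f x"
  shows "0 < (\<integral>x. f x \<partial>lborel)"
proof -
  have "(\<integral>x. f x \<partial>lborel) \<noteq> 0"
  proof
    assume "(\<integral>x. f x \<partial>lborel) = 0"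
    then have "AE x in lborel. f x = 0"
      using integral_nonneg_eq_0_iff_AE[OF int] pos by (simp add: less_imp_le)
    then have "AE x in (lborel :: 'a measure). False"
      by eventually_elim (use pos less_irrefl in metis)
    then show False by (simp add: eventually_False ae_filter_eq_bot_iff)
  qed
  moreover have "0 \<le> (\<integral>x. f x \<partial>lborel)"
    using pos less_imp_le by (intro integral_nonneg_AE) blast
  ultimately show ?thesis by linarith
qed

lemma probit_risk_strictly_convex:
  assumes "0 < w" "0 < s" "0 < s'" "(a, s) \<noteq> (a', s')" "0 < l" "l < 1"
  shows "probit_risk y \<mu> w ((1 - l) * a + l * a') ((1 - l) * s + l * s')
    < (1 - l) * probit_risk y \<mu> w a s + l * probit_risk y \<mu> w a' s'"
proof -
  let ?L = "probit_loss y \<mu> w"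
  let ?D = "\<lambda>z. std_normal_density z * ((1 - l) * ?L a s z + l * ?L a' s' z - ?L ((1 - l) * a + l * a') ((1 - l) * s + l * s') z)"
  have D: "?D = (\<lambda>z. (1 - l) * (std_normal_density z * ?L a s z) + l * (std_normal_density z * ?L a' s' z)
     - std_normal_density z * ?L ((1 - l) * a + l * a') ((1 - l) * s + l * s') z)"
    by (simp add: fun_eq_iff algebra_simps)
  have int: "integrable lborel ?D"
    unfolding D by (intro Bochner_Integration.integrable_diff Bochner_Integration.integrable_add
        integrable_mult_right integrable_probit_loss)
  have pos: "0 < ?D z" for z
    using probit_loss_strictly_convex[OF assms] by (simp add: normal_density_pos)
  have "0 < (\<integral>z. ?D z \<partial>lborel)"
    by (rule integral_lborel_pos[OF int pos])
  moreover have "(\<integral>z. ?D z \<partial>lborel) = (1 - l) * probit_risk y \<mu> w a s + l * probit_risk y \<mu> w a' s'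
     - probit_risk y \<mu> w ((1 - l) * a + l * a') ((1 - l) * s + l * s')"
    unfolding D probit_risk_def by (simp add: integrable_probit_loss)
  ultimately show ?thesis by linarith
qed

text \<open>The competitor \<open>s'\<close> may lie beyond \<open>r\<close>. A short step from
  \<open>(a, s)\<close> towards it stays in the open strip, and by strict convexity it would lower
  the risk there.\<close>

lemma probit_risk_minimizer_unique:
  assumes w: "0 < w" and s: "0 < s" "s < r" and s': "0 < s'"
    and min: "\<And>b u. 0 < u \<Longrightarrow> u < r \<Longrightarrow> probit_risk y \<mu> w a s \<le> probit_risk y \<mu> w b u"
    and le: "probit_risk y \<mu> w a' s' \<le> probit_risk y \<mu> w a s"
  shows "a' = a \<and> s' = s"
proof (rule ccontr)
  assume "\<not> ?thesis"
  then have ne: "(a, s) \<noteq> (a', s')" by auto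
  \<comment> \<open>The second bound gives \<open>l * s' \<le> (r - s) / 2\<close>, so the step
    stays below \<open>r\<close>; the first keeps \<open>l\<close> below one.\<close>
  define l where "l = min (1/2) ((r - s) / (2 * s'))"
  have l: "0 < l" "l < 1" using s s' by (auto simp: l_def)
  have "l * s' \<le> (r - s) / (2 * s') * s'"
    using s' by (intro mult_right_mono) (auto simp: l_def)
  also have "\<dots> = (r - s) / 2" using s' by simp
  finally have "l * s' < r - s" using s by simp
  moreover have "(1 - l) * s \<le> s" using l s by (simp add: algebra_simps)
  ultimately have "(1 - l) * s + l * s' < r" by linarith
  moreover have "0 < (1 - l) * s + l * s'" using l s s' by (simp add: add_pos_pos)
  ultimately have "probit_risk y \<mu> w a s \<le> probit_risk y \<mu> w ((1 - l) * a + l * a') ((1 - l) * s + l * s')"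
    by (rule min[rotated])
  also have "\<dots> < (1 - l) * probit_risk y \<mu> w a s + l * probit_risk y \<mu> w a' s'"
    by (rule probit_risk_strictly_convex[OF w s(1) s' ne l])
  also have "\<dots> \<le> (1 - l) * probit_risk y \<mu> w a s + l * probit_risk y \<mu> w a s"
    using le l by simp
  finally show False by (simp add: algebra_simps)
qed

text \<open>Substitute \<open>t = a + sqrt v * z\<close>. The logarithms of the normalising
  constants form a summand independent of \<open>a\<close> and \<open>v\<close>, so comparing
  divergences amounts to comparing risks.\<close>

lemma
  fixes a v \<mu> w y Z :: real
  assumes v: "0 < v" and w: "0 < w" and Z: "0 < Z"
  defines "g \<equiv> \<lambda>t. npdf1 a v t * ln (npdf1 a v t / (npdf1 \<mu> w t * Phi (y * t) / Z))"
  shows integrable_npdf1_probit: "integrable lborel g"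
    and integral_npdf1_probit: "(\<integral>t. g t \<partial>lborel) =
      probit_risk y \<mu> w a (sqrt v) + (ln Z + ln (sqrt (2 * pi * w)) - ln (sqrt (2 * pi)))"
proof -
  define s where "s = sqrt v"
  define C where "C = ln Z + ln (sqrt (2 * pi * w)) - ln (sqrt (2 * pi))"
  have s: "0 < s" "v = s\<^sup>2" using v by (auto simp: s_def)
  have affine: "g (a + s * z) = (std_normal_density z * probit_loss y \<mu> w a s z + C * std_normal_density z) / s" for z
  proof -
    let ?t = "a + s * z"
    have density: "npdf1 a v ?t = std_normal_density z / s"
      using s v by (simp add: npdf1_eq std_normal_density_def power_mult_distrib real_sqrt_mult)
    have "ln (npdf1 a v ?t) = - z\<^sup>2 / 2 - ln (sqrt (2 * pi)) - ln s"
      using s(1) unfolding density by (simp add: std_normal_density_def ln_div ln_mult)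
    moreover have "ln (npdf1 \<mu> w ?t) = - (?t - \<mu>)\<^sup>2 / (2 * w) - ln (sqrt (2 * pi * w))"
      using w by (simp add: npdf1_eq ln_div)
    moreover have "ln (npdf1 a v ?t / (npdf1 \<mu> w ?t * Phi (y * ?t) / Z)) =
        ln (npdf1 a v ?t) - (ln (npdf1 \<mu> w ?t) + ln (Phi (y * ?t)) - ln Z)"
      using npdf1_pos[OF v, of a ?t] npdf1_pos[OF w, of \<mu> ?t] Phi_pos[of "y * ?t"] Z
      by (simp add: ln_div ln_mult)
    ultimately have "ln (npdf1 a v ?t / (npdf1 \<mu> w ?t * Phi (y * ?t) / Z)) = probit_loss y \<mu> w a s z + C"
      by (simp add: probit_loss_def C_def)
    then have "g ?t = std_normal_density z / s * (probit_loss y \<mu> w a s z + C)"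
      unfolding g_def density by simp
    then show ?thesis by (simp add: distrib_left add_divide_distrib mult.commute)
  qed
  have int: "integrable lborel (\<lambda>z. std_normal_density z * probit_loss y \<mu> w a s z + C * std_normal_density z)"
    by (intro Bochner_Integration.integrable_add integrable_mult_right integrable_probit_loss) simp
  then have "integrable lborel (\<lambda>z. g (a + s * z))"
    unfolding affine by simp
  then show "integrable lborel g"
    using lborel_integrable_real_affine_iff[of s g a] s by simp
  have "(\<integral>t. g t \<partial>lborel) = s * (\<integral>z. g (a + s * z) \<partial>lborel)"
    using lborel_integral_real_affine[of s g a] s by simp
  also have "\<dots> = (\<integral>z. std_normal_density z * probit_loss y \<mu> w a s z + C * std_normal_density z \<partial>lborel)"
    unfolding affine using s by simp
  also have "\<dots> = probit_risk y \<mu> w a s + C"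
    by (subst Bochner_Integration.integral_add) (simp_all add: probit_risk_def integrable_probit_loss)
  finally show "(\<integral>t. g t \<partial>lborel) = probit_risk y \<mu> w a (sqrt v) + (ln Z + ln (sqrt (2 * pi * w)) - ln (sqrt (2 * pi)))"
    by (simp add: s_def C_def)
qed

subsection \<open>Relative entropy\<close>

text \<open>Adding \<open>r x - p x\<close> to the integrand leaves the integral unchanged, since
  the masses agree, and makes it pointwise nonnegative by \<open>ln x \<le> x - 1\<close>, with
  equality only where \<open>p x = r x\<close>.\<close>

lemma Gibbs_inequality:
  fixes p r :: "'a \<Rightarrow> real"
  assumes pos: "\<And>x. 0 < p x" "\<And>x. 0 < r x"
    and int: "integrable M p" "integrable M r" "integral\<^sup>L M p = integral\<^sup>L M r"
    and kl: "integrable M (\<lambda>x. p x * ln (p x / r x))"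
  shows "0 \<le> (\<integral>x. p x * ln (p x / r x) \<partial>M)"
    and "(\<integral>x. p x * ln (p x / r x) \<partial>M) \<le> 0 \<Longrightarrow> AE x in M. p x = r x"
proof -
  define D where "D x = p x * ln (p x / r x) - p x + r x" for x
  have D: "0 \<le> D x" "D x = 0 \<Longrightarrow> p x = r x" for x
  proof -
    have "ln (p x / r x) = - ln (r x / p x)"
      using pos[of x] by (simp add: ln_div)
    then have eq: "D x = p x * ((r x / p x - 1) - ln (r x / p x))"
      using pos[of x] by (simp add: D_def field_simps)
    show "0 \<le> D x"
      unfolding eq using pos[of x] ln_le_minus_one[of "r x / p x"] by simp
    show "p x = r x" if "D x = 0"
      using that ln_eq_minus_one[of "r x / p x"] pos[of x] by (simp add: eq)
  qed
  have int_D: "integrable M D"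
    unfolding D_def[abs_def] by (intro Bochner_Integration.integrable_add Bochner_Integration.integrable_diff int kl)
  have "integral\<^sup>L M D = (\<integral>x. p x * ln (p x / r x) \<partial>M) - integral\<^sup>L M p + integral\<^sup>L M r"
    unfolding D_def[abs_def] using int kl by simp
  then have eq: "integral\<^sup>L M D = (\<integral>x. p x * ln (p x / r x) \<partial>M)"
    using int by simp
  have nonneg: "0 \<le> integral\<^sup>L M D" using D by (intro integral_nonneg_AE) simp
  then show "0 \<le> (\<integral>x. p x * ln (p x / r x) \<partial>M)" by (simp add: eq)
  assume "(\<integral>x. p x * ln (p x / r x) \<partial>M) \<le> 0"
  then have "integral\<^sup>L M D = 0" using nonneg eq by simp
  then have "AE x in M. D x = 0"
    using integral_nonneg_eq_0_iff_AE[OF int_D] D by simp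
  then show "AE x in M. p x = r x"
    by eventually_elim (rule D)
qed

text \<open>Integrals determine densities only almost everywhere; continuity of normal densities
  upgrades this, because a nonempty open set is not null.\<close>

lemma continuous_AE_eq_imp_eq:
  fixes f g :: "'a::euclidean_space \<Rightarrow> real"
  assumes "continuous_on UNIV f" "continuous_on UNIV g" "AE x in lborel. f x = g x"
  shows "f = g"
proof -
  have "open {x. f x \<noteq> g x}"
    using assms(1,2) by (rule open_Collect_neq)
  moreover have "{x. f x \<noteq> g x} \<in> null_sets lborel"
  proof -
    have "{x. f x \<noteq> g x} \<in> sets lborel" using calculation by simp
    then show ?thesis using assms(3) by (subst AE_iff_null_sets) auto
  qed
  then have "negligible {x. f x \<noteq> g x}"
    by (simp add: negligible_iff_null_sets null_sets_completionI)
  ultimately have "{x. f x \<noteq> g x} = {}"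
    using open_not_negligible by blast
  then show ?thesis by auto
qed

lemma normalize_dens_scale:
  assumes "K \<noteq> 0" "(\<integral>z. f z \<partial>lborel) = 1"
  shows "normalize_dens (\<lambda>x. K * f x) = f"
  using assms by (simp add: normalize_dens_def)

lemma normalize_dens_mvn_pdf: "sym_pos_def B \<Longrightarrow> normalize_dens (mvn_pdf a B) = mvn_pdf a B"
  by (simp add: normalize_dens_def integral_mvn_pdf)

lemma integral_npdf1: "0 < v \<Longrightarrow> (\<integral>t. npdf1 a v t \<partial>lborel) = 1"
  and integrable_npdf1: "0 < v \<Longrightarrow> integrable lborel (npdf1 a v)"
  unfolding npdf1_def by auto

lemma probit_evidence_pos:
  assumes w: "0 < w"
  shows "0 < (\<integral>t. npdf1 \<mu> w t * Phi (y * t) \<partial>lborel)"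
proof -
  have int: "integrable lborel (\<lambda>t. npdf1 \<mu> w t * Phi (y * t))"
  proof (rule Bochner_Integration.integrable_bound[OF integrable_npdf1[OF w, of \<mu>]])
    show "AE t in lborel. norm (npdf1 \<mu> w t * Phi (y * t)) \<le> norm (npdf1 \<mu> w t)"
      by (intro AE_I2) (simp add: abs_mult Phi_nonneg Phi_le_1 mult_left_le)
  qed measurable
  have pos: "0 < npdf1 \<mu> w t * Phi (y * t)" for t
    using npdf1_pos[OF w] Phi_pos by simp
  show ?thesis by (rule integral_lborel_pos[OF int pos])
qed

text \<open>Dividing by the marginal density \<open>npdf1 b w\<close> and multiplying by
  \<open>npdf1 c u\<close> exchanges the marginal of coordinate \<open>i\<close>; the old one
  cancels after reduction to one dimension.\<close>

lemma integral_mvn_pdf_tilt: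
  assumes S: "sym_pos_def S" and h[measurable]: "h \<in> borel_measurable borel"
    and w: "w = S $ i $ i" and b: "b = a $ i"
  shows "(\<integral>m. mvn_pdf a S m * (npdf1 c u (m $ i) / npdf1 b w (m $ i) * h (m $ i)) \<partial>lborel)
      = (\<integral>t. npdf1 c u t * h t \<partial>lborel)"
    and "integrable lborel (\<lambda>m. mvn_pdf a S m * (npdf1 c u (m $ i) / npdf1 b w (m $ i) * h (m $ i)))
      \<longleftrightarrow> integrable lborel (\<lambda>t. npdf1 c u t * h t)"
proof -
  have cancel: "npdf1 (a $ i) (S $ i $ i) t * (npdf1 c u t / npdf1 b w t * h t) = npdf1 c u t * h t" for t
    using npdf1_pos[OF sym_pos_def_diag_pos[OF S], of "a $ i" i t] by (simp add: w b)
  have meas: "(\<lambda>t. npdf1 c u t / npdf1 b w t * h t) \<in> borel_measurable borel" by measurable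
  show "(\<integral>m. mvn_pdf a S m * (npdf1 c u (m $ i) / npdf1 b w (m $ i) * h (m $ i)) \<partial>lborel)
      = (\<integral>t. npdf1 c u t * h t \<partial>lborel)"
    using integral_mvn_pdf_coord[OF S meas, of a i] unfolding cancel .
  show "integrable lborel (\<lambda>m. mvn_pdf a S m * (npdf1 c u (m $ i) / npdf1 b w (m $ i) * h (m $ i)))
      \<longleftrightarrow> integrable lborel (\<lambda>t. npdf1 c u t * h t)"
    using integrable_mvn_pdf_coord[OF S meas, of a i] unfolding cancel .
qed

theorem theorem1:
  fixes \<mu> :: "real^'n" and \<Sigma> :: "real^'n^'n" and i :: 'n and y :: real
    and \<mu>c :: "real^'n" and \<Sigma>c :: "real^'n^'n" and \<mu>t :: real and s2 :: real
  assumes prior: "sym_pos_def \<Sigma>"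
    and y: "y \<in> {-1, 1}"
    and min1: "sym_pos_def \<Sigma>c"
      "\<forall>\<mu>' \<Sigma>'. sym_pos_def \<Sigma>' \<longrightarrow>
         KL (mvn_pdf \<mu>c \<Sigma>c) (\<lambda>m. mvn_pdf \<mu> \<Sigma> m * Phi (y * m $ i))
           \<le> KL (mvn_pdf \<mu>' \<Sigma>') (\<lambda>m. mvn_pdf \<mu> \<Sigma> m * Phi (y * m $ i))"
    and min2: "s2 > 0"
      "\<forall>a v. v > 0 \<longrightarrow>
         KL (marg (\<lambda>m. mvn_pdf \<mu> \<Sigma> m * npdf1 \<mu>t s2 (m $ i)) i)
            (marg (\<lambda>m. mvn_pdf \<mu> \<Sigma> m * Phi (y * m $ i)) i)
           \<le> KL (marg (\<lambda>m. mvn_pdf \<mu> \<Sigma> m * npdf1 a v (m $ i)) i)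
            (marg (\<lambda>m. mvn_pdf \<mu> \<Sigma> m * Phi (y * m $ i)) i)"
  shows "mvn_pdf \<mu>c \<Sigma>c = normalize_dens (\<lambda>m. mvn_pdf \<mu> \<Sigma> m * npdf1 \<mu>t s2 (m $ i))"
proof -
  define q where "q = mvn_pdf \<mu> \<Sigma>"
  define b w where "b = \<mu> $ i" and "w = \<Sigma> $ i $ i"
  define p where "p = mvn_pdf \<mu>c \<Sigma>c"
  define a v where "a = \<mu>c $ i" and "v = \<Sigma>c $ i $ i"
  define Z where "Z = (\<integral>t. npdf1 b w t * Phi (y * t) \<partial>lborel)"
  define C where "C = ln Z + ln (sqrt (2 * pi * w)) - ln (sqrt (2 * pi))"
  define L where "L a v t = ln (npdf1 a v t / (npdf1 b w t * Phi (y * t) / Z))" for a v t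
  have w: "0 < w" and v: "0 < v"
    using sym_pos_def_diag_pos[OF prior] sym_pos_def_diag_pos[OF min1(1)] by (simp_all add: w_def v_def)
  have Z: "0 < Z" unfolding Z_def by (rule probit_evidence_pos[OF w])
  have L[measurable]: "L a v \<in> borel_measurable borel" for a v
    unfolding L_def[abs_def] by measurable
  have risk: "integrable lborel (\<lambda>t. npdf1 a v t * L a v t)"
    "(\<integral>t. npdf1 a v t * L a v t \<partial>lborel) = probit_risk y b w a (sqrt v) + C" if "0 < v" for a v
    using integrable_npdf1_probit[OF that w Z, of a b y] integral_npdf1_probit[OF that w Z, of a b y]
    unfolding L_def C_def by auto

  have marg_posterior: "normalize_dens (marg (\<lambda>m. q m * Phi (y * m $ i)) i) = (\<lambda>t. npdf1 b w t * Phi (y * t) / Z)"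
  proof -
    have "marg (\<lambda>m. q m * Phi (y * m $ i)) i = (\<lambda>t. npdf1 b w t * Phi (y * t))"
      using marg_mvn_pdf[OF prior, of \<mu> "\<lambda>t. Phi (y * t)" i] by (simp add: fun_eq_iff q_def b_def w_def)
    then show ?thesis by (simp add: normalize_dens_def Z_def)
  qed
  \<comment> \<open>The same \<open>Z\<close> normalises the posterior and its marginal, as the
    likelihood sees only \<open>m $ i\<close>.\<close>
  have posterior: "normalize_dens (\<lambda>m. q m * Phi (y * m $ i)) = (\<lambda>m. q m * Phi (y * m $ i) / Z)"
    using integral_mvn_pdf_coord[OF prior, of "\<lambda>t. Phi (y * t)" \<mu> i]
    by (simp add: normalize_dens_def Z_def q_def b_def w_def)

  \<comment> \<open>A factor with parameters \<open>a\<close>, \<open>v\<close> turns the prior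
    marginal into the normal density with summed precisions, so its divergence is the risk at the
    updated mean and scale.\<close>
  have KL_marg: "KL (marg (\<lambda>m. q m * npdf1 a v (m $ i)) i) (marg (\<lambda>m. q m * Phi (y * m $ i)) i) =
      ereal (probit_risk y b w ((b * v + a * w) / (w + v)) (sqrt (w * v / (w + v))) + C)" if v: "0 < v" for a v
  proof -
    define c u where "c = (b * v + a * w) / (w + v)" and "u = w * v / (w + v)"
    have u: "0 < u" using v w by (simp add: u_def)
    obtain K where K: "0 < K" "\<And>t. npdf1 b w t * npdf1 a v t = K * npdf1 c u t"
      by (rule npdf1_mult_npdf1[OF w v, of b a, folded c_def u_def]) (rule that)
    have "marg (\<lambda>m. q m * npdf1 a v (m $ i)) i = (\<lambda>t. K * npdf1 c u t)"
      using marg_mvn_pdf[OF prior, of \<mu> "npdf1 a v" i] K by (simp add: fun_eq_iff q_def b_def w_def)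
    then have "normalize_dens (marg (\<lambda>m. q m * npdf1 a v (m $ i)) i) = npdf1 c u"
      using K u by (simp add: normalize_dens_scale integral_npdf1)
    then show ?thesis
      using risk[OF u, of c] unfolding KL_def marg_posterior L_def c_def u_def by (simp add: Let_def)
  qed

  define c u where "c = (b * s2 + \<mu>t * w) / (w + s2)" and "u = w * s2 / (w + s2)"
  have u: "0 < u" "u < w" using w min2(1) by (simp_all add: u_def field_simps)
  have marg_min: "probit_risk y b w c (sqrt u) \<le> probit_risk y b w x s" if s: "0 < s" "s < sqrt w" for x s
  proof -
    have sw: "s\<^sup>2 < w" using s w by (metis abs_of_pos real_less_rsqrt real_sqrt_abs real_sqrt_less_iff)
    \<comment> \<open>Inverting the update: \<open>v\<close> solves
      \<open>1 / s\<^sup>2 = 1 / w + 1 / v\<close>, and \<open>a\<close> then solves the equation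
      for the mean. So every point of the strip is attained by some factor.\<close>
    define v where "v = w * s\<^sup>2 / (w - s\<^sup>2)"
    define a where "a = (x * (w + v) - b * v) / w"
    have v: "0 < v" using w s sw by (simp add: v_def)
    have "w + v = w * w / (w - s\<^sup>2)" using sw by (simp add: v_def field_simps)
    then have "w * v / (w + v) = s\<^sup>2" using sw w by (simp add: v_def field_simps)
    moreover have "(b * v + a * w) / (w + v) = x" using w v by (simp add: a_def)
    ultimately show ?thesis
      using min2(2)[rule_format, OF v, of a] KL_marg[OF v, of a] KL_marg[OF min2(1), of \<mu>t] s
      unfolding q_def[symmetric] c_def u_def by simp
  qed

  \<comment> \<open>Marginal with parameters \<open>a\<close>, \<open>v\<close> in coordinate
    \<open>i\<close>, conditionals of the prior given that coordinate.\<close>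
  define tilt where "tilt a v m = q m * (npdf1 a v (m $ i) / npdf1 b w (m $ i))" for a v m
  have q_pos: "0 < q m" for m using mvn_pdf_pos[OF prior] by (simp add: q_def)
  have tilt_pos: "0 < tilt a v m" if "0 < v" for a v m
    using q_pos npdf1_pos[OF that] npdf1_pos[OF w] by (simp add: tilt_def)
  \<comment> \<open>The common factor \<open>q m\<close> cancels, so the log-ratio to the posterior
    depends on \<open>m $ i\<close> only.\<close>
  have tilt_log: "ln (tilt a v m / (q m * Phi (y * m $ i) / Z)) = L a v (m $ i)" for a v m
    using q_pos[of m] by (simp add: tilt_def L_def)

  obtain a' S' K where S': "sym_pos_def S'" and K: "0 < K"
    and prod: "\<And>m. q m * npdf1 \<mu>t s2 (m $ i) = K * mvn_pdf a' S' m"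
    by (rule mvn_pdf_mult_npdf1[OF prior min2(1), of \<mu> \<mu>t i, folded q_def]) (rule that)
  have norm: "normalize_dens (\<lambda>m. q m * npdf1 \<mu>t s2 (m $ i)) = mvn_pdf a' S'"
    unfolding prod using K S' by (intro normalize_dens_scale) (auto simp: integral_mvn_pdf)
  \<comment> \<open>Both sides are normalised and proportional to the prior times the optimal
    factor.\<close>
  have tilt_eq: "tilt c u = mvn_pdf a' S'"
  proof -
    obtain K' where K': "0 < K'" "\<And>t. npdf1 b w t * npdf1 \<mu>t s2 t = K' * npdf1 c u t"
      by (rule npdf1_mult_npdf1[OF w min2(1), of b \<mu>t, folded c_def u_def]) (rule that)
    have "K' * tilt c u m = q m * npdf1 \<mu>t s2 (m $ i)" for m
      using K'(2)[of "m $ i"] npdf1_pos[OF w, of b "m $ i"]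
      by (simp add: tilt_def field_simps)
    then have "normalize_dens (\<lambda>m. K' * tilt c u m) = mvn_pdf a' S'"
      using norm by simp
    moreover have "(\<integral>m. tilt c u m \<partial>lborel) = 1"
      using integral_mvn_pdf_tilt(1)[OF prior, of "\<lambda>_. 1" w i b \<mu> c u] u
      by (simp add: tilt_def q_def b_def w_def integral_npdf1)
    ultimately show ?thesis
      using K' normalize_dens_scale[of K' "tilt c u"] by simp
  qed

  have KL_tilt: "KL (mvn_pdf a' S') (\<lambda>m. q m * Phi (y * m $ i)) = ereal (probit_risk y b w c (sqrt u) + C)"
  proof -
    let ?g = "\<lambda>m. tilt c u m * ln (tilt c u m / (q m * Phi (y * m $ i) / Z))"
    have g: "?g m = mvn_pdf \<mu> \<Sigma> m * (npdf1 c u (m $ i) / npdf1 b w (m $ i) * L c u (m $ i))" for m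
      unfolding tilt_log by (simp add: tilt_def q_def)
    have "integrable lborel ?g" "(\<integral>m. ?g m \<partial>lborel) = probit_risk y b w c (sqrt u) + C"
      unfolding g integral_mvn_pdf_tilt[OF prior L w_def b_def] by (rule risk[OF u(1)])+
    then show ?thesis
      unfolding KL_def normalize_dens_mvn_pdf[OF S'] posterior tilt_eq by (simp add: Let_def)
  qed

  define g where "g m = p m * ln (p m / (q m * Phi (y * m $ i) / Z))" for m
  have KL_p: "KL p (\<lambda>m. q m * Phi (y * m $ i)) = (if integrable lborel g then ereal (\<integral>m. g m \<partial>lborel) else \<infinity>)"
    unfolding KL_def p_def normalize_dens_mvn_pdf[OF min1(1)] posterior g_def[abs_def] by (simp add: Let_def)
  \<comment> \<open>The outcome of the second approach is normal, hence a competitor for the first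
    minimiser. Its divergence is finite, which also forces integrability of
    \<open>g\<close>.\<close>
  have le: "KL p (\<lambda>m. q m * Phi (y * m $ i)) \<le> ereal (probit_risk y b w c (sqrt u) + C)"
    using min1(2)[rule_format, OF S', of a'] KL_tilt by (simp add: p_def q_def)
  have int_g: "integrable lborel g"
    using le unfolding KL_p by (auto split: if_splits)
  have g_le: "(\<integral>m. g m \<partial>lborel) \<le> probit_risk y b w c (sqrt u) + C"
    using le int_g unfolding KL_p by simp

  text \<open>Chain rule: the divergence of \<open>p\<close> from the posterior splits into the divergence of \<open>p\<close> from the density
    with the marginal of \<open>p\<close> in coordinate \<open>i\<close> and the conditionals of the prior, and a divergence of
    one-dimensional marginals.\<close>
  define r where "r = tilt a v"
  have p_pos: "0 < p m" for m using mvn_pdf_pos[OF min1(1)] by (simp add: p_def)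
  have r_pos: "0 < r m" for m using tilt_pos[OF v] by (simp add: r_def)
  have int_L: "integrable lborel (\<lambda>m. p m * L a v (m $ i))"
    and L_eq: "(\<integral>m. p m * L a v (m $ i) \<partial>lborel) = probit_risk y b w a (sqrt v) + C"
    using risk[OF v, of a] integrable_mvn_pdf_coord[OF min1(1) L[of a v], of \<mu>c i]
      integral_mvn_pdf_coord[OF min1(1) L[of a v], of \<mu>c i]
    by (simp_all add: p_def a_def v_def)
  have chain: "p m * ln (p m / r m) = g m - p m * L a v (m $ i)" for m
  proof -
    have "ln (p m / (q m * Phi (y * m $ i) / Z)) = ln (p m / r m) + ln (r m / (q m * Phi (y * m $ i) / Z))"
      using p_pos[of m] r_pos[of m] q_pos[of m] Phi_pos[of "y * m $ i"] Z
      by (simp add: ln_div ln_mult)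
    then show ?thesis
      unfolding g_def r_def tilt_log by (simp add: algebra_simps)
  qed
  have int_pr: "integrable lborel (\<lambda>m. p m * ln (p m / r m))"
    unfolding chain by (intro Bochner_Integration.integrable_diff int_g int_L)
  have pr_eq: "(\<integral>m. p m * ln (p m / r m) \<partial>lborel) = (\<integral>m. g m \<partial>lborel) - (probit_risk y b w a (sqrt v) + C)"
    unfolding chain using int_g int_L L_eq by simp
  have int_r: "integrable lborel r" "(\<integral>m. r m \<partial>lborel) = 1"
    using integral_mvn_pdf_tilt[OF prior, of "\<lambda>_. 1" w i b \<mu> a v] v
    by (simp_all add: r_def tilt_def[abs_def] q_def b_def w_def integral_npdf1 integrable_npdf1)
  note gibbs = Gibbs_inequality[of p r lborel, OF p_pos r_pos _ int_r(1) _ int_pr]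
  have int_p: "integrable lborel p" "integral\<^sup>L lborel p = integral\<^sup>L lborel r"
    using integrable_mvn_pdf[OF min1(1)] integral_mvn_pdf[OF min1(1)] int_r(2) by (simp_all add: p_def)
  \<comment> \<open>Dropping the nonnegative divergence of \<open>p\<close> from \<open>r\<close>
    leaves the inequality between the one-dimensional parts.\<close>
  have "probit_risk y b w a (sqrt v) \<le> probit_risk y b w c (sqrt u)"
    using gibbs(1)[OF int_p] pr_eq g_le by linarith
  \<comment> \<open>Uniqueness is applied with \<open>r = sqrt w\<close>; no upper bound on
    \<open>v\<close> is available at this point.\<close>
  then have "a = c \<and> sqrt v = sqrt u"
  proof (rule probit_risk_minimizer_unique[OF w, rotated -1])
    show "probit_risk y b w c (sqrt u) \<le> probit_risk y b w x s" if "0 < s" "s < sqrt w" for x s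
      using that by (rule marg_min)
  qed (use u v in auto)
  then have av: "a = c" "v = u" by auto
  \<comment> \<open>With equal one-dimensional parts, nothing is left for the divergence of
    \<open>p\<close> from \<open>r\<close>: the equality case of Gibbs applies.\<close>
  have "AE m in lborel. p m = r m"
    using gibbs(2)[OF int_p] pr_eq g_le av by simp
  then have "AE m in lborel. mvn_pdf \<mu>c \<Sigma>c m = mvn_pdf a' S' m"
    by (simp add: p_def r_def av tilt_eq)
  then have "mvn_pdf \<mu>c \<Sigma>c = mvn_pdf a' S'"
    by (intro continuous_AE_eq_imp_eq continuous_mvn_pdf min1(1) S')
  then show ?thesis using norm by (simp add: q_def)
qed

end
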